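(* For each $\mathfrak{s}=(s_{1},\ldots,s_{r})\in\mathbb{N}^{r}$, the following identity holds in $\mathcal{A}_{k}$: \[ \zeta_{\mathcal{A}_{k}}(\mathfrak{s})=\frac{1}{\Gamma_{\mathfrak{s}}}\sum_{\mathbf{j}\in J_{\mathfrak{s}}}a_{\mathbf{j}}(\theta)\,\mathrm{Li}_{\mathcal{A}_{k},\mathfrak{s}}(\mathbf{u}_{\mathbf{j}}). \]
   Context: Let $\mathbb{F}_{q}$ be the finite field with $q$ elements, $A:=\mathbb{F}_{q}[\theta]$, $k:=\mathbb{F}_q(\theta)$. Define the $k$-algebra $\mathcal{A}_{k}:=\prod_{P}A/(P)\big/\bigoplus_{P}A/(P)$, $P$ running over all monic irreducible polynomials of $A$ (an element of $k$ acts componentwise via its reduction mod $P$ for all but finitely many $P$). Finite multiple zeta values: for $\mathfrak{s}=(s_{1},\ldots,s_{r})\in\mathbb{N}^{r}$ ($\mathbb{N}$ = positive integers) and $P$ monic irreducible, $\zeta_{\mathcal{A}_{k}}(\mathfrak{s})_{P}:=\sum \frac{1}{a_{1}^{s_{1}}\cdots a_{r}^{s_{r}}}\bmod P$, summed over monic $a_{1},\ldots,a_{r}\in A$ with $\deg P>\deg a_{1}>\cdots>\deg a_{r}$, and $\zeta_{\mathcal{A}_{k}}(\mathfrak{s}):=(\zeta_{\mathcal{A}_{k}}(\mathfrak{s})_{P})_P\in\mathcal{A}_{k}$. Finite Carlitz multiple polylogarithms: let $L_{0}:=1$ and $L_{i}:=(\theta-\theta^{q})(\theta-\theta^{q^2})\cdots(\theta-\theta^{q^{i}})$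 for $i\ge1$. For $\mathbf{u}=(u_{1},\ldots,u_{r})\in k^{r}$ and $P$ not dividing the denominators of the $u_i$, set $\mathrm{Li}_{\mathcal{A}_{k},\mathfrak{s}}(\mathbf{u})_{P}:=\sum_{\deg P>i_{1}>\cdots>i_{r}\ge0}\frac{u_{1}^{q^{i_{1}}}\cdots u_{r}^{q^{i_{r}}}}{L_{i_{1}}^{s_{1}}\cdots L_{i_{r}}^{s_{r}}}\bmod P\in A/(P)$ (well defined since $P\nmid L_i$ for $i<\deg P$), and $\mathrm{Li}_{\mathcal{A}_{k},\mathfrak{s}}(\mathbf{u}):=(\mathrm{Li}_{\mathcal{A}_{k},\mathfrak{s}}(\mathbf{u})_P)_P\in\mathcal{A}_k$. Anderson–Thakur polynomials: let $t,x,y$ be independent variables. Put $G_{0}(y):=1$ and $G_{n}(y):=\prod_{i=1}^{n}(t^{q^{n}}-y^{q^{i}})\in\mathbb{F}_q[t,y]$ for $n\ge1$. Let $D_{0}:=1$ and $D_{i}:=\prod_{j=0}^{i-1}(\theta^{q^{i}}-\theta^{q^{j}})$ for $i\ge1$. For $n\ge0$ with base-$q$ expansion $n=\sum n_{i}q^{i}$ ($0\le n_i\le q-1$), define the Carlitz factorial $\Gamma_{n+1}:=\prod_i D_{i}^{n_{i}}\in A$. The Anderson–Thakur polynomials $H_{n}\in A[t]$ ($n\ge0$) are defined by \[\Big(1-\sum_{i=0}^{\infty}\frac{G_{i}(\theta)}{D_{i}|_{\theta=t}}x^{q^{i}}\Big)^{-1}=\sum_{n=0}^{\infty}\frac{H_{n}}{\Gamma_{n+1}|_{\theta=t}}x^{n}.\]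 Data attached to $\mathfrak{s}$: for each $1\le i\le r$ write $H_{s_{i}-1}=\sum_{j=0}^{m_{i}}u_{ij}t^{j}$ with $u_{ij}\in A$ and $u_{im_{i}}\neq0$. Let $J_{\mathfrak{s}}:=\{0,\ldots,m_{1}\}\times\cdots\times\{0,\ldots,m_{r}\}$; for $\mathbf{j}=(j_{1},\ldots,j_{r})\in J_{\mathfrak{s}}$ set $\mathbf{u}_{\mathbf{j}}:=(u_{1j_{1}},\ldots,u_{rj_{r}})\in A^{r}$ and $a_{\mathbf{j}}(t):=t^{j_{1}+\cdots+j_{r}}$, so $a_{\mathbf{j}}(\theta)=\theta^{j_1+\cdots+j_r}$. Finally $\Gamma_{\mathfrak{s}}:=\Gamma_{s_{1}}\cdots\Gamma_{s_{r}}\in A$. *)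

theory Defs
  imports "HOL-Computational_Algebra.Computational_Algebra" "HOL-Library.Cardinality"
begin

text \<open>
  The field with $q$ elements is a type \<open>'a\<close> of sort \<open>{field, finite}\<close>, so \<open>q = CARD('a)\<close>,
  \<open>A = 'a poly\<close> and \<open>k = 'a poly fract\<close>.  In the ring \<open>A[t] = 'a poly poly\<close> the outer variable
  is $t$ and the inner one is $\theta$.
\<close>

definition theta :: "'a::{field,finite} poly"
  where "theta = monom 1 1"

abbreviation monic :: "'a::{field,finite} poly \<Rightarrow> bool"
  where "monic p \<equiv> lead_coeff p = 1"

definition monic_irreducible :: "'a::{field,finite} poly \<Rightarrow> bool"
  where "monic_irreducible P \<longleftrightarrow> monic P \<and> irreducible P"


section \<open>The ring $\mathcal{A}_k$\<close>

lemma finite_degree_le: "finite {p :: 'a::{field,finite} poly. degree p \<le> n}"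
proof -
  have "p \<in> Poly ` {xs. set xs \<subseteq> UNIV \<and> length xs \<le> Suc n}" if "degree p \<le> n" for p :: "'a poly"
    using that by (intro image_eqI[of _ _ "coeffs p"]) (auto simp: length_coeffs_degree, cases "p = 0", auto simp: length_coeffs_degree)
  then have "{p :: 'a poly. degree p \<le> n} \<subseteq> Poly ` {xs. set xs \<subseteq> UNIV \<and> length xs \<le> Suc n}"
    by blast
  then show ?thesis
    by (rule finite_subset) (intro finite_imageI finite_lists_length_le, simp)
qed

lemma finite_divisors_poly:
  fixes b :: "'a::{field,finite} poly"
  assumes "b \<noteq> 0"
  shows "finite {P. P dvd b}"
  by (rule finite_subset[OF _ finite_degree_le[of "degree b"]])
     (use assms in \<open>auto intro: dvd_imp_degree_le\<close>)

lemma monic_irreducible_divisor_exists: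
  fixes p :: "'a::{field,finite} poly"
  assumes "0 < degree p"
  shows "\<exists>P. monic_irreducible P \<and> P dvd p"
  using assms
proof (induction "degree p" arbitrary: p rule: less_induct)
  case less
  show ?case
  proof (cases "irreducible p")
    case True
    define c where "c = inverse (lead_coeff p)"
    have c: "c \<noteq> 0" "p \<noteq> 0" using less.prems by (auto simp: c_def)
    have "irreducible (smult c p)"
    proof -
      have "smult c p = [:c:] * p" by simp
      moreover have "is_unit [:c:]" using c by (simp add: is_unit_triv)
      ultimately show ?thesis using True irreducible_mult_unit_left by metis
    qed
    moreover have "monic (smult c p)" using c by (simp add: c_def)
    moreover have "smult c p dvd p" using c by (simp add: smult_dvd)
    ultimately show ?thesis unfolding monic_irreducible_def by blast
  next
    case False
    have "p \<noteq> 0" using less.prems by auto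
    then have "\<not> is_unit p" using less.prems is_unit_iff_degree[of p] by auto
    with False \<open>p \<noteq> 0\<close> obtain a b where ab: "p = a * b" "\<not> is_unit a" "\<not> is_unit b"
      unfolding irreducible_def by blast
    then have "a \<noteq> 0" "b \<noteq> 0" using \<open>p \<noteq> 0\<close> by auto
    with ab have "0 < degree a" "0 < degree b" using is_unit_iff_degree by blast+
    then have "degree a < degree p" using ab \<open>a \<noteq> 0\<close> \<open>b \<noteq> 0\<close> by (simp add: degree_mult_eq)
    from less.hyps[OF this \<open>0 < degree a\<close>] ab show ?thesis by (metis dvd_mult2)
  qed
qed

lemma infinite_monic_irreducible: "infinite {P :: 'a::{field,finite} poly. monic_irreducible P}"
proof
  assume fin: "finite {P :: 'a poly. monic_irreducible P}"
  let ?N = "\<Prod>{P :: 'a poly. monic_irreducible P}"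
  let ?x = "theta :: 'a poly"
  have N: "?N \<noteq> 0" using fin by (auto simp: monic_irreducible_def)
  have x: "?x \<noteq> 0" "degree ?x = 1" by (auto simp: theta_def degree_monom_eq)
  have "degree (?x * ?N + 1) = degree (?x * ?N)"
    by (rule degree_add_eq_left) (use N x in \<open>simp add: degree_mult_eq\<close>)
  also have "\<dots> > 0" using N x by (simp add: degree_mult_eq)
  finally obtain P where P: "monic_irreducible P" "P dvd ?x * ?N + 1"
    using monic_irreducible_divisor_exists by blast
  have "P dvd ?N" using fin P(1) by (intro dvd_prod_eqI[of _ P]) auto
  then have "P dvd 1" using P(2) by (metis dvd_add_right_iff dvd_mult)
  then show False using P(1) by (simp add: monic_irreducible_def irreducible_def)
qed

text \<open>
  An element of $\prod_P A/(P)$ is given by a family of representatives in $A$; two families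
  define the same element of $\mathcal{A}_k$ iff they are congruent modulo \<open>P\<close> for all but
  finitely many monic irreducible \<open>P\<close>.  The values of a family at other arguments are irrelevant.
\<close>

definition Ak_rel :: "('a::{field,finite} poly \<Rightarrow> 'a poly) \<Rightarrow> ('a poly \<Rightarrow> 'a poly) \<Rightarrow> bool"
  where "Ak_rel f g \<longleftrightarrow> finite {P. monic_irreducible P \<and> \<not> P dvd f P - g P}"

lemma Ak_relI:
  assumes "finite S" "\<And>P. monic_irreducible P \<Longrightarrow> P \<notin> S \<Longrightarrow> P dvd f P - g P"
  shows "Ak_rel f g"
  unfolding Ak_rel_def by (rule finite_subset[OF _ assms(1)]) (use assms(2) in auto)

lemma Ak_relE:
  assumes "Ak_rel f g"
  obtains S where "finite S" "\<And>P. monic_irreducible P \<Longrightarrow> P \<notin> S \<Longrightarrow> P dvd f P - g P"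
  using assms unfolding Ak_rel_def by blast

lemma equivp_Ak_rel:
  "equivp (Ak_rel :: ('a::{field,finite} poly \<Rightarrow> 'a poly) \<Rightarrow> _)" (is "equivp ?R")
proof (rule equivpI)
  show "reflp ?R" by (rule reflpI) (simp add: Ak_rel_def)
  show "symp ?R"
    by (rule sympI) (simp add: Ak_rel_def dvd_diff_commute)
  show "transp ?R"
  proof (rule transpI)
    fix f g h :: "'a poly \<Rightarrow> 'a poly"
    assume "Ak_rel f g" "Ak_rel g h"
    then obtain S T where "finite S" "finite T"
      and S: "\<And>P. monic_irreducible P \<Longrightarrow> P \<notin> S \<Longrightarrow> P dvd f P - g P"
      and T: "\<And>P. monic_irreducible P \<Longrightarrow> P \<notin> T \<Longrightarrow> P dvd g P - h P"
      by (metis Ak_relE)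
    show "Ak_rel f h"
    proof (rule Ak_relI[of "S \<union> T"])
      fix P :: "'a poly" assume "monic_irreducible P" "P \<notin> S \<union> T"
      then have "P dvd (f P - g P) + (g P - h P)" using S T by (intro dvd_add) auto
      then show "P dvd f P - h P" by simp
    qed (use \<open>finite S\<close> \<open>finite T\<close> in auto)
  qed
qed

quotient_type (overloaded) 'a Ak = "'a::{field,finite} poly \<Rightarrow> 'a poly" / Ak_rel
  by (rule equivp_Ak_rel)

instantiation Ak :: ("{field,finite}") comm_ring_1
begin

lift_definition zero_Ak :: "'a Ak" is "\<lambda>_. 0" .
lift_definition one_Ak :: "'a Ak" is "\<lambda>_. 1" .

lift_definition uminus_Ak :: "'a Ak \<Rightarrow> 'a Ak" is "\<lambda>f P. - f P"
  unfolding Ak_rel_def by (simp add: minus_diff_commute dvd_diff_commute)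

lift_definition plus_Ak :: "'a Ak \<Rightarrow> 'a Ak \<Rightarrow> 'a Ak" is "\<lambda>f g P. f P + g P"
proof -
  fix f f' g g' :: "'a poly \<Rightarrow> 'a poly"
  assume "Ak_rel f f'" "Ak_rel g g'"
  then obtain S T where "finite S" "finite T"
    and S: "\<And>P. monic_irreducible P \<Longrightarrow> P \<notin> S \<Longrightarrow> P dvd f P - f' P"
    and T: "\<And>P. monic_irreducible P \<Longrightarrow> P \<notin> T \<Longrightarrow> P dvd g P - g' P"
    by (metis Ak_relE)
  show "Ak_rel (\<lambda>P. f P + g P) (\<lambda>P. f' P + g' P)"
  proof (rule Ak_relI[of "S \<union> T"])
    fix P :: "'a poly" assume "monic_irreducible P" "P \<notin> S \<union> T"
    then have "P dvd (f P - f' P) + (g P - g' P)" using S T by (intro dvd_add) auto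
    then show "P dvd f P + g P - (f' P + g' P)" by (simp add: algebra_simps)
  qed (use \<open>finite S\<close> \<open>finite T\<close> in auto)
qed

lift_definition times_Ak :: "'a Ak \<Rightarrow> 'a Ak \<Rightarrow> 'a Ak" is "\<lambda>f g P. f P * g P"
proof -
  fix f f' g g' :: "'a poly \<Rightarrow> 'a poly"
  assume "Ak_rel f f'" "Ak_rel g g'"
  then obtain S T where "finite S" "finite T"
    and S: "\<And>P. monic_irreducible P \<Longrightarrow> P \<notin> S \<Longrightarrow> P dvd f P - f' P"
    and T: "\<And>P. monic_irreducible P \<Longrightarrow> P \<notin> T \<Longrightarrow> P dvd g P - g' P"
    by (metis Ak_relE)
  show "Ak_rel (\<lambda>P. f P * g P) (\<lambda>P. f' P * g' P)"
  proof (rule Ak_relI[of "S \<union> T"])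
    fix P :: "'a poly" assume "monic_irreducible P" "P \<notin> S \<union> T"
    then have "P dvd (f P - f' P) * g P + f' P * (g P - g' P)" using S T by (intro dvd_add) auto
    then show "P dvd f P * g P - f' P * g' P" by (simp add: algebra_simps)
  qed (use \<open>finite S\<close> \<open>finite T\<close> in auto)
qed

definition minus_Ak :: "'a Ak \<Rightarrow> 'a Ak \<Rightarrow> 'a Ak"
  where "minus_Ak x y = x + - y"

instance
proof
  have "\<not> Ak_rel (\<lambda>_. 0) (\<lambda>_. 1 :: 'a poly)"
  proof -
    have "{P :: 'a poly. monic_irreducible P \<and> \<not> P dvd 0 - 1} = {P. monic_irreducible P}"
      by (auto simp: monic_irreducible_def irreducible_def)
    then show ?thesis using infinite_monic_irreducible by (simp add: Ak_rel_def)
  qed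
  then show "(0 :: 'a Ak) \<noteq> 1" by transfer
qed (unfold minus_Ak_def, (transfer, simp add: Ak_rel_def algebra_simps)+)

end


section \<open>The $k$-algebra structure\<close>

definition integral_at :: "'a::{field,finite} poly \<Rightarrow> 'a poly fract \<Rightarrow> bool"
  where "integral_at P x \<longleftrightarrow> (\<exists>a b. x = Fract a b \<and> \<not> P dvd b)"

text \<open>
  For irreducible \<open>P\<close>, \<open>residue P x\<close> is the reduction of \<open>x\<close> modulo \<open>P\<close>, given by its
  representative of degree less than \<open>degree P\<close>.  It is set to \<open>0\<close> if \<open>P\<close> divides the
  denominator of \<open>x\<close>, which for fixed \<open>x\<close> happens for finitely many \<open>P\<close> only.
\<close>

definition residue :: "'a::{field,finite} poly \<Rightarrow> 'a poly fract \<Rightarrow> 'a poly"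
  where "residue P x =
    (if integral_at P x
     then THE c. c mod P = c \<and> (\<exists>a b. x = Fract a b \<and> \<not> P dvd b \<and> P dvd b * c - a)
     else 0)"

lemma inverse_mod_exists:
  fixes P b :: "'a::{field,finite} poly"
  assumes P: "irreducible P" and b: "\<not> P dvd b"
  shows "\<exists>c. P dvd b * c - 1"
  using b
proof (induction "degree b" arbitrary: b rule: less_induct)
  case less
  have nz: "P \<noteq> 0" "b \<noteq> 0" using P less.prems by (auto simp: irreducible_def)
  consider "is_unit b" | "degree P \<le> degree b" | "\<not> is_unit b" "degree b < degree P" by linarith
  then show ?case
  proof cases
    case 1
    then obtain c where "1 = b * c" by (auto simp: dvd_def)
    then show ?thesis by (metis diff_self dvd_0_right)
  next
    case 2
    have "\<not> P dvd b mod P" using less.prems by (simp add: dvd_mod_iff)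
    moreover from this have "b mod P \<noteq> 0" by auto
    then have "degree (b mod P) < degree b" using degree_mod_less[OF nz(1), of b] 2 by auto
    ultimately obtain c where c: "P dvd b mod P * c - 1" using less.hyps by blast
    have "b * c - 1 = (P * (b div P) + b mod P) * c - 1" by simp
    also have "\<dots> = P * (b div P * c) + (b mod P * c - 1)" by (simp only: algebra_simps)
    finally have "P dvd b * c - 1" using c by (simp only: dvd_add dvd_triv_left)
    then show ?thesis by blast
  next
    case 3
    define r where "r = P mod b"
    define d where "d = P div b"
    have eq: "P = b * d + r" by (simp add: r_def d_def)
    have "r \<noteq> 0"
    proof
      assume "r = 0"
      then have "P = b * d" using eq by simp
      with P have "is_unit b \<or> is_unit d" by (rule irreducibleD)
      with 3 have "is_unit d" by blast
      then have "b * d dvd b" by simp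
      then have "P dvd b" unfolding \<open>P = b * d\<close> .
      with less.prems show False by simp
    qed
    then have deg: "degree r < degree b" using degree_mod_less[OF nz(2), of P] by (auto simp: r_def)
    have "\<not> P dvd r" using dvd_imp_degree_le[of P r] \<open>r \<noteq> 0\<close> deg 3 by auto
    from less.hyps[OF deg this] obtain c where c: "P dvd r * c - 1" by blast
    have "r = P - b * d" using eq by (simp add: r_def d_def minus_mult_div_eq_mod)
    then have "r * c - 1 = P * c + (b * (- d * c) - 1)" by (simp add: left_diff_distrib mult.assoc)
    with c have "P dvd P * c + (b * (- d * c) - 1)" by simp
    then have "P dvd b * (- d * c) - 1" by (metis dvd_add_right_iff dvd_triv_left)
    then show ?thesis by blast
  qed
qed

lemma residue_eqI:
  fixes P a b c :: "'a::{field,finite} poly"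
  assumes P: "irreducible P" and b: "\<not> P dvd b" and c: "P dvd b * c - a"
  shows "residue P (Fract a b) = c mod P"
proof -
  have prime: "prime_elem P" by (rule field_poly_irreducible_imp_prime[OF P])
  have "P dvd c - c mod P" by (simp add: minus_mod_eq_mult_div)
  then have "P dvd (b * c - a) - b * (c - c mod P)" by (rule dvd_diff[OF c dvd_mult])
  moreover have "(b * c - a) - b * (c - c mod P) = b * (c mod P) - a" by (simp add: right_diff_distrib)
  ultimately have c': "P dvd b * (c mod P) - a" by simp
  have "(THE r. r mod P = r \<and> (\<exists>a' b'. Fract a b = Fract a' b' \<and> \<not> P dvd b' \<and> P dvd b' * r - a'))
    = c mod P"
  proof (rule the_equality)
    show "c mod P mod P = c mod P \<and>
      (\<exists>a' b'. Fract a b = Fract a' b' \<and> \<not> P dvd b' \<and> P dvd b' * (c mod P) - a')"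
      using b c' by auto
  next
    fix r
    assume r: "r mod P = r \<and> (\<exists>a' b'. Fract a b = Fract a' b' \<and> \<not> P dvd b' \<and> P dvd b' * r - a')"
    then obtain a' b' where ab: "Fract a b = Fract a' b'" "\<not> P dvd b'" "P dvd b' * r - a'" by blast
    have "b \<noteq> 0" "b' \<noteq> 0" using b ab(2) by auto
    then have eq: "a * b' = a' * b" using ab(1) by (simp add: eq_fract)
    have "P dvd b * (b' * r - a') - b' * (b * c - a)" by (rule dvd_diff[OF dvd_mult[OF ab(3)] dvd_mult[OF c]])
    also have "b * (b' * r - a') - b' * (b * c - a) = b * b' * (r - c)
      + (a * b' - a' * b)" by (simp add: algebra_simps)
    also have "\<dots> = b * b' * (r - c)" by (simp only: eq diff_self add_0_right)
    finally have "P dvd r - c" using prime b ab(2) by (simp add: prime_elem_dvd_mult_iff)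
    then have "r mod P = c mod P" by (simp add: mod_eq_dvd_iff)
    then show "r = c mod P" using r by simp
  qed
  moreover have "integral_at P (Fract a b)" using b by (auto simp: integral_at_def)
  ultimately show ?thesis by (simp add: residue_def)
qed

lemma residue_Fract:
  fixes P a b :: "'a::{field,finite} poly"
  assumes P: "irreducible P" and b: "\<not> P dvd b"
  shows "P dvd b * residue P (Fract a b) - a"
proof -
  obtain i where i: "P dvd b * i - 1" using inverse_mod_exists[OF P b] by blast
  then have "P dvd a * (b * i - 1)" by simp
  then have *: "P dvd b * (a * i) - a" by (simp add: algebra_simps)
  have "P dvd b * (a * i - (a * i) mod P)" by (simp add: minus_mod_eq_mult_div)
  then have "P dvd (b * (a * i) - a) - b * (a * i - (a * i) mod P)" by (rule dvd_diff[OF *])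
  moreover have "(b * (a * i) - a) - b * (a * i - (a * i) mod P) = b * (a * i mod P) - a"
    by (simp add: right_diff_distrib)
  ultimately show ?thesis by (simp only: residue_eqI[OF P b *])
qed

lemma Ak_rel_residue:
  fixes a b :: "'a::{field,finite} poly"
  assumes "b \<noteq> 0"
    and "\<And>P. monic_irreducible P \<Longrightarrow> \<not> P dvd b \<Longrightarrow> P dvd b * f P - a"
  shows "Ak_rel (\<lambda>P. residue P (Fract a b)) f"
proof (rule Ak_relI[OF finite_divisors_poly[OF assms(1)]])
  fix P :: "'a poly" assume P: "monic_irreducible P" "P \<notin> {P. P dvd b}"
  then have "residue P (Fract a b) = f P mod P"
    using assms(2) by (intro residue_eqI) (auto simp: monic_irreducible_def)
  then show "P dvd residue P (Fract a b) - f P"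
    by (simp add: mod_eq_dvd_iff[symmetric])
qed

lift_definition scale_k :: "'a::{field,finite} poly fract \<Rightarrow> 'a Ak \<Rightarrow> 'a Ak" (infixr "*\<^sub>k" 75)
  is "\<lambda>c f P. residue P c * f P"
proof -
  fix c :: "'a poly fract" and f g :: "'a poly \<Rightarrow> 'a poly"
  assume "Ak_rel f g"
  then obtain S where "finite S" and S: "\<And>P. monic_irreducible P \<Longrightarrow> P \<notin> S \<Longrightarrow> P dvd f P - g P"
    by (rule Ak_relE) blast
  then show "Ak_rel (\<lambda>P. residue P c * f P) (\<lambda>P. residue P c * g P)"
    by (intro Ak_relI[of S]) (auto simp flip: right_diff_distrib)
qed

lemmas Ak_abs_eqs =
  scale_k.abs_eq one_Ak.abs_eq plus_Ak.abs_eq times_Ak.abs_eq Ak.abs_eq_iff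

lemma scale_k_eq: "c *\<^sub>k x = (c *\<^sub>k 1) * x"
  by (induction x rule: Ak.abs_induct) (simp add: Ak_abs_eqs)

lemma scale_k_one: "1 *\<^sub>k 1 = (1 :: 'a::{field,finite} Ak)"
proof -
  have "Ak_rel (\<lambda>P. residue P (Fract 1 1)) (\<lambda>_. 1 :: 'a poly)"
    by (rule Ak_rel_residue) auto
  then show ?thesis by (simp add: Ak_abs_eqs One_fract_def)
qed

lemma scale_k_add:
  fixes c d :: "'a::{field,finite} poly fract"
  shows "(c + d) *\<^sub>k 1 = c *\<^sub>k 1 + d *\<^sub>k (1 :: 'a Ak)"
proof -
  obtain a b where c: "c = Fract a b" "b \<noteq> 0" by (cases c) auto
  obtain a' b' where d: "d = Fract a' b'" "b' \<noteq> 0" by (cases d) auto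
  have "Ak_rel (\<lambda>P. residue P (Fract (a * b' + a' * b) (b * b'))) (\<lambda>P. residue P c + residue P d)"
  proof (rule Ak_rel_residue)
    fix P :: "'a poly" assume P: "monic_irreducible P" "\<not> P dvd b * b'"
    then have "P dvd b * residue P c - a" "P dvd b' * residue P d - a'"
      unfolding c d by (auto intro!: residue_Fract simp: monic_irreducible_def)
    then have "P dvd b' * (b * residue P c - a) + b * (b' * residue P d - a')"
      by (intro dvd_add dvd_mult)
    then show "P dvd b * b' * (residue P c + residue P d) - (a * b' + a' * b)"
      by (simp add: algebra_simps)
  qed (use c d in auto)
  then show ?thesis using c d by (simp add: Ak_abs_eqs)
qed

lemma scale_k_mult:
  fixes c d :: "'a::{field,finite} poly fract"
  shows "(c * d) *\<^sub>k 1 = (c *\<^sub>k 1) * (d *\<^sub>k (1 :: 'a Ak))"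
proof -
  obtain a b where c: "c = Fract a b" "b \<noteq> 0" by (cases c) auto
  obtain a' b' where d: "d = Fract a' b'" "b' \<noteq> 0" by (cases d) auto
  have "Ak_rel (\<lambda>P. residue P (Fract (a * a') (b * b'))) (\<lambda>P. residue P c * residue P d)"
  proof (rule Ak_rel_residue)
    fix P :: "'a poly" assume P: "monic_irreducible P" "\<not> P dvd b * b'"
    then have "P dvd b * residue P c - a" "P dvd b' * residue P d - a'"
      unfolding c d by (auto intro!: residue_Fract simp: monic_irreducible_def)
    then have "P dvd (b * residue P c - a) * (b' * residue P d) + a * (b' * residue P d - a')"
      by (intro dvd_add dvd_mult dvd_mult2)
    then show "P dvd b * b' * (residue P c * residue P d) - a * a'"
      by (simp add: algebra_simps)
  qed (use c d in auto)
  then show ?thesis using c d by (simp add: Ak_abs_eqs)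
qed

lemma scale_k_mult_left: "c *\<^sub>k (x * y) = (c *\<^sub>k x) * y"
  unfolding scale_k_eq[of c "x * y"] scale_k_eq[of c x] by (rule mult.assoc[symmetric])

lemma vector_space_Ak:
  "vector_space (scale_k :: 'a::{field,finite} poly fract \<Rightarrow> 'a Ak \<Rightarrow> 'a Ak)"
proof
  fix c d :: "'a poly fract" and x y :: "'a Ak"
  show "c *\<^sub>k (x + y) = c *\<^sub>k x + c *\<^sub>k y"
    unfolding scale_k_eq[of c "x + y"] scale_k_eq[of c x] scale_k_eq[of c y]
    by (rule distrib_left)
  show "(c + d) *\<^sub>k x = c *\<^sub>k x + d *\<^sub>k x"
    unfolding scale_k_eq[of "c + d" x] scale_k_eq[of c x] scale_k_eq[of d x] scale_k_add
    by (rule distrib_right)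
  show "c *\<^sub>k d *\<^sub>k x = (c * d) *\<^sub>k x"
    unfolding scale_k_eq[of "c * d" x] scale_k_eq[of d x] scale_k_mult scale_k_mult_left
      scale_k_eq[of c "d *\<^sub>k 1"] ..
  show "1 *\<^sub>k x = x"
    unfolding scale_k_eq[of 1 x] scale_k_one by (rule mult_1)
qed


section \<open>Finite multiple zeta values\<close>

definition zeta_index :: "nat list \<Rightarrow> 'a::{field,finite} poly \<Rightarrow> 'a poly list set"
  where "zeta_index s P =
    {xs. length xs = length s \<and> (\<forall>a\<in>set xs. monic a \<and> degree a < degree P) \<and>
         sorted_wrt (>) (map degree xs)}"

definition zeta_Ak_at :: "nat list \<Rightarrow> 'a::{field,finite} poly \<Rightarrow> 'a poly"
  where "zeta_Ak_at s P =
    residue P (\<Sum>xs\<in>zeta_index s P. 1 / (\<Prod>i<length s. to_fract (xs ! i) ^ (s ! i)))"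

lift_definition zeta_Ak :: "nat list \<Rightarrow> 'a::{field,finite} Ak" is zeta_Ak_at .


section \<open>Finite Carlitz multiple polylogarithms\<close>

text \<open>
  \<open>residue P\<close> is applied to the sum, formed in $k$.  For \<open>P\<close> dividing the denominator of some
  entry of \<open>u\<close> the value of \<open>Li_Ak_at s u P\<close> is irrelevant, as there are finitely many such \<open>P\<close>.
\<close>

definition carlitz_L :: "nat \<Rightarrow> 'a::{field,finite} poly"
  where "carlitz_L i = (\<Prod>j=1..i. theta - theta ^ (CARD('a) ^ j))"

definition Li_index :: "nat list \<Rightarrow> 'a::{field,finite} poly \<Rightarrow> nat list set"
  where "Li_index s P =
    {is. length is = length s \<and> (\<forall>i\<in>set is. i < degree P) \<and> sorted_wrt (>) is}"

definition Li_Ak_at ::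
    "nat list \<Rightarrow> 'a::{field,finite} poly fract list \<Rightarrow> 'a poly \<Rightarrow> 'a poly"
  where "Li_Ak_at s u P =
    residue P (\<Sum>is\<in>Li_index s P. \<Prod>l<length s.
      (u ! l) ^ (CARD('a) ^ (is ! l)) / to_fract (carlitz_L (is ! l)) ^ (s ! l))"

lift_definition Li_Ak :: "nat list \<Rightarrow> 'a::{field,finite} poly fract list \<Rightarrow> 'a Ak"
  is Li_Ak_at .

lemma finite_zeta_index: "finite (zeta_index s (P :: 'a::{field,finite} poly))"
proof (rule finite_subset)
  show "zeta_index s P \<subseteq> {xs. set xs \<subseteq> {p. degree p \<le> degree P} \<and> length xs = length s}"
    by (auto simp: zeta_index_def less_imp_le)
qed (intro finite_lists_length_eq finite_degree_le)

lemma finite_Li_index: "finite (Li_index s (P :: 'a::{field,finite} poly))"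
proof (rule finite_subset)
  show "Li_index s P \<subseteq> {is. set is \<subseteq> {..<degree P} \<and> length is = length s}"
    by (auto simp: Li_index_def)
qed (intro finite_lists_length_eq finite_lessThan)


section \<open>Anderson--Thakur polynomials\<close>

text \<open>
  \<open>AT_G n y\<close> is $G_n(y)$; it is evaluated at $y = \theta$ only, i.e. at the constant polynomial
  \<open>[:theta:]\<close> of $A[t]$.
\<close>

definition AT_G :: "nat \<Rightarrow> 'a::{field,finite} poly poly \<Rightarrow> 'a poly poly"
  where "AT_G n y = (\<Prod>i=1..n. monom 1 (CARD('a) ^ n) - y ^ (CARD('a) ^ i))"

definition carlitz_D :: "nat \<Rightarrow> 'a::{field,finite} poly"
  where "carlitz_D i = (\<Prod>j<i. theta ^ (CARD('a) ^ i) - theta ^ (CARD('a) ^ j))"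

text \<open>
  \<open>carlitz_gamma n\<close> is $\Gamma_n$ for \<open>n \<ge> 1\<close>, so that the base-\<open>q\<close> digits are those of
  \<open>n - 1\<close>; the digits at positions \<open>i \<ge> n\<close> vanish since $q^n > n - 1$.
\<close>

definition carlitz_gamma :: "nat \<Rightarrow> 'a::{field,finite} poly"
  where "carlitz_gamma n = (\<Prod>i<n. carlitz_D i ^ ((n - 1) div CARD('a) ^ i mod CARD('a)))"

text \<open>The substitution $\theta \mapsto t$, from $A$ to $\mathbb{F}_q[t] \subseteq A[t]$.\<close>

definition at_t :: "'a::{field,finite} poly \<Rightarrow> 'a poly poly"
  where "at_t p = map_poly (\<lambda>c. [:c:]) p"

text \<open>
  The series $\sum_i G_i(\theta) / D_i|_{\theta = t} \, x^{q^i}$, with coefficients in the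
  fraction field of $A[t]$.  The inner sum has one term if \<open>n\<close> is a power of \<open>q\<close> and is empty
  otherwise.
\<close>

definition AT_series :: "'a::{field,finite} poly poly fract fps"
  where "AT_series = Abs_fps (\<lambda>n. \<Sum>i\<in>{i. CARD('a) ^ i = n}.
    to_fract (AT_G i [:theta:]) / to_fract (at_t (carlitz_D i)))"

definition AT_H :: "nat \<Rightarrow> 'a::{field,finite} poly poly"
  where "AT_H n = (THE h. fps_nth (inverse (1 - AT_series)) n =
    to_fract h / to_fract (at_t (carlitz_gamma (n + 1))))"


section \<open>The data attached to an index\<close>

text \<open>The type argument records the field $\mathbb{F}_q$ over which \<open>AT_H\<close> is taken.\<close>

definition J_index :: "'a::{field,finite} itself \<Rightarrow> nat list \<Rightarrow> nat list set"
  where "J_index _ s = {js. length js = length s \<and>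
    (\<forall>i<length s. js ! i \<le> degree (AT_H (s ! i - 1) :: 'a poly poly))}"

definition u_vec :: "nat list \<Rightarrow> nat list \<Rightarrow> 'a::{field,finite} poly fract list"
  where "u_vec s js = map (\<lambda>i. to_fract (coeff (AT_H (s ! i - 1)) (js ! i))) [0..<length s]"

definition a_poly :: "nat list \<Rightarrow> 'a::{field,finite} poly poly"
  where "a_poly js = monom 1 (sum_list js)"

definition Gamma_index :: "nat list \<Rightarrow> 'a::{field,finite} poly"
  where "Gamma_index s = (\<Prod>i<length s. carlitz_gamma (s ! i))"

end

theory Submission
  imports Defs
begin

text \<open>
  For monic $a$ of degree $d$, Carlitz's formula
  $\prod_a (X - a) = D_d \bigl(\sum_{i \le d} X^{q^i} / (D_i L_{d-i}^{q^i}) - 1\bigr)$ has a constant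
  derivative, so logarithmic differentiation gives the generating series of the power sums
  $S_d(n + 1) = \sum_a a^{-n-1}$:
  \[ \sum_n S_d(n + 1) x^n = \frac{1}{L_d}
     \Bigl(1 - \sum_{i \le d} \frac{x^{q^i}}{D_i L_{d-i}^{q^i}}\Bigr)^{-1}. \]
  Raising the coefficients of $G_i(\theta)$ to the $q^d$-th power and then putting $t = \theta$
  gives $L_d^{q^i} / L_{d-i}^{q^i}$ for $i \le d$, and $0$ for $i > d$.  Under this operation the
  generating series of the Anderson--Thakur polynomials becomes the series above with $x$ replaced
  by $L_d x$, whence
  $S_d(n + 1) = H_n^{(d)}(\theta) / (\Gamma_{n+1} L_d^{n+1})$.  Expanding $H_n$ into its
  coefficients and summing products over $\deg P > d_1 > \dots > d_r \ge 0$ yields an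
  identity in $k$ for every \<open>P\<close>, to be reduced modulo \<open>P\<close>.
\<close>

section \<open>The Frobenius\<close>

text \<open>For nonzero x, multiplication by x permutes the nonzero elements, so their product does
  not change; pulling out the q - 1 factors x and cancelling the product gives the claim.\<close>

lemma finite_field_pow_card:
  fixes x :: "'a::{field,finite}"
  shows "x ^ CARD('a) = x"
proof (cases "x = 0")
  case False
  have "x * (\<Prod>y\<in>UNIV-{0}. x * y) = x * x ^ (CARD('a) - 1) * \<Prod>(UNIV-{0})"
    by (simp add: prod.distrib mult_ac)
  also have "x * x ^ (CARD('a) - 1) = x ^ Suc (CARD('a) - 1)"
    by (rule power_Suc[symmetric])
  also have "Suc (CARD('a) - 1) = CARD('a)"
    using finite_UNIV_card_ge_0[where ?'a = 'a] by simp
  also have "(\<Prod>y\<in>UNIV-{0}. x * y) = (\<Prod>y\<in>UNIV-{0}. y)"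
    by (rule prod.reindex_bij_witness[of _ "\<lambda>y. y / x" "\<lambda>y. x * y"]) (use False in auto)
  finally show ?thesis by simp
qed (use finite_UNIV_card_ge_0[where ?'a = 'a] in auto)

lemma finite_field_pow_card_pow:
  fixes x :: "'a::{field,finite}"
  shows "x ^ (CARD('a) ^ n) = x"
  by (induction n) (simp_all add: power_mult finite_field_pow_card)

lemma card_field_gt_1: "CARD('a::{field,finite}) > 1"
proof -
  have "card {0, 1 :: 'a} \<le> CARD('a)" by (rule card_mono) auto
  then show ?thesis by simp
qed

text \<open>The polynomial $(X + 1)^q - X^q - 1$ has degree less than $q$ and vanishes on the whole field.\<close>

lemma of_nat_card_choose_eq_0:
  assumes "0 < k" "k < CARD('a)"
  shows "of_nat (CARD('a) choose k) = (0 :: 'a::{field,finite})"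
proof -
  define q where "q = CARD('a)"
  have q: "q > 1" unfolding q_def by (rule card_field_gt_1)
  have eq: "[:1, 1 :: 'a:] ^ q = monom 1 q + 1"
  proof (rule poly_eqI_degree_lead_coeff[of _ q _ UNIV])
    have "degree ([:1, 1 :: 'a:] ^ q) = q" by (simp add: degree_linear_power)
    moreover have "lead_coeff ([:1, 1 :: 'a:] ^ q) = 1" by (simp add: lead_coeff_power)
    ultimately show "coeff ([:1, 1 :: 'a:] ^ q) q = coeff (monom 1 q + 1) q"
      using q by (simp add: coeff_1)
    show "degree (monom (1 :: 'a) q + 1) \<le> q"
      by (rule degree_add_le) (auto simp: degree_monom_eq)
    show "poly ([:1, 1 :: 'a:] ^ q) z = poly (monom 1 q + 1) z" for z
      by (simp add: poly_monom q_def finite_field_pow_card add.commute)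
  qed (auto simp: q_def degree_linear_power)
  have "coeff ([:1, 1 :: 'a:] ^ q) k = of_nat (q choose k)"
    using assms by (subst coeff_linear_poly_power) (auto simp: q_def)
  then show ?thesis using assms unfolding eq by (simp add: q_def coeff_1)
qed

lemma of_nat_card_eq_0: "of_nat CARD('a) = (0 :: 'a::{field,finite})"
  using of_nat_card_choose_eq_0[of 1, where 'a='a] card_field_gt_1[where 'a='a] by simp

text \<open>Only the two outer terms of the binomial expansion survive. The ring is kept general so
  that both A and k are covered.\<close>

lemma add_power_distrib:
  fixes x y :: "'b::comm_semiring_1"
  assumes "0 < n" and "\<And>k. 0 < k \<Longrightarrow> k < n \<Longrightarrow> of_nat (n choose k) = (0 :: 'b)"
  shows "(x + y) ^ n = x ^ n + y ^ n"
proof -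
  have "(x + y) ^ n = (\<Sum>k\<le>n. of_nat (n choose k) * x ^ k * y ^ (n - k))"
    by (rule binomial_ring)
  also have "\<dots> = (\<Sum>k\<in>{0,n}. of_nat (n choose k) * x ^ k * y ^ (n - k))"
    by (rule sum.mono_neutral_right) (use assms in auto)
  also have "\<dots> = x ^ n + y ^ n"
    using assms(1) by (simp add: add.commute)
  finally show ?thesis .
qed

lemma to_fract_of_nat [simp]: "to_fract (of_nat n) = of_nat n"
  by (induction n) simp_all

lemma to_fract_prod [simp]: "to_fract (prod f A) = (\<Prod>x\<in>A. to_fract (f x))"
  by (induction A rule: infinite_finite_induct) simp_all

lemma to_fract_power [simp]: "to_fract (x ^ n) = to_fract x ^ n"
  by (induction n) simp_all

lemma add_pow_card_poly:
  fixes x y :: "'a::{field,finite} poly"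
  shows "(x + y) ^ (CARD('a) ^ n) = x ^ (CARD('a) ^ n) + y ^ (CARD('a) ^ n)"
proof (induction n)
  case (Suc n)
  have "(u + v) ^ CARD('a) = u ^ CARD('a) + v ^ CARD('a)" for u v :: "'a poly"
    by (rule add_power_distrib) (simp_all add: of_nat_poly of_nat_card_choose_eq_0)
  then show ?case by (simp add: power_mult Suc mult.commute[of "CARD('a)"])
qed simp

lemma add_pow_card_fract:
  fixes x y :: "'a::{field,finite} poly fract"
  shows "(x + y) ^ (CARD('a) ^ n) = x ^ (CARD('a) ^ n) + y ^ (CARD('a) ^ n)"
proof (induction n)
  case (Suc n)
  have "(u + v) ^ CARD('a) = u ^ CARD('a) + v ^ CARD('a)" for u v :: "'a poly fract"
  proof (rule add_power_distrib)
    fix k assume "0 < k" "k < CARD('a)"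
    then have "to_fract (of_nat (CARD('a) choose k) :: 'a poly) = 0"
      by (simp add: of_nat_poly of_nat_card_choose_eq_0)
    then show "of_nat (CARD('a) choose k) = (0 :: 'a poly fract)" by (simp only: to_fract_of_nat)
  qed simp
  then show ?case by (simp add: power_mult Suc mult.commute[of "CARD('a)"])
qed simp

lemma diff_pow_card_poly:
  fixes x y :: "'a::{field,finite} poly"
  shows "(x - y) ^ (CARD('a) ^ n) = x ^ (CARD('a) ^ n) - y ^ (CARD('a) ^ n)"
  using add_pow_card_poly[of "x - y" y n] by (simp add: algebra_simps)

lemma sum_pow_card_fract:
  fixes f :: "'b \<Rightarrow> 'a::{field,finite} poly fract"
  shows "(\<Sum>x\<in>S. f x) ^ (CARD('a) ^ n) = (\<Sum>x\<in>S. f x ^ (CARD('a) ^ n))"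
  by (induction S rule: infinite_finite_induct) (simp_all add: add_pow_card_fract)

section \<open>Carlitz's formula\<close>

lemma theta_pow: "theta ^ n = monom 1 n"
  by (simp add: theta_def monom_power)

lemma theta_pow_card_inj:
  "theta ^ (CARD('a) ^ i) = (theta ^ (CARD('a) ^ j) :: 'a::{field,finite} poly) \<longleftrightarrow> i = j"
proof -
  have "CARD('a) ^ i = CARD('a) ^ j \<longleftrightarrow> i = j"
    using card_field_gt_1[where 'a='a] by (rule power_inject_exp)
  then show ?thesis by (auto simp: theta_pow monom_eq_iff')
qed

lemma carlitz_D_nonzero: "carlitz_D i \<noteq> 0"
  by (auto simp: carlitz_D_def theta_pow_card_inj)

lemma carlitz_L_nonzero: "carlitz_L i \<noteq> (0 :: 'a::{field,finite} poly)"
proof -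
  have "theta \<noteq> (theta ^ (CARD('a) ^ j) :: 'a poly)" if "j \<ge> 1" for j
    using theta_pow_card_inj[of 0 j, where 'a='a] that by simp
  then show ?thesis by (auto simp: carlitz_L_def)
qed

text \<open>The factor with j = 0 is split off; by additivity of the q-th power, the remaining
  factors are the q-th powers of the factors of D_i.\<close>

lemma carlitz_D_Suc:
  "carlitz_D (Suc i) =
    (theta ^ (CARD('a) ^ Suc i) - theta) * (carlitz_D i ^ CARD('a) :: 'a::{field,finite} poly)"
proof -
  have "(carlitz_D i :: 'a poly) ^ CARD('a)
    = (\<Prod>j<i. theta ^ (CARD('a) ^ Suc i) - theta ^ (CARD('a) ^ Suc j))"
    unfolding carlitz_D_def prod_power_distrib
    by (simp add: diff_pow_card_poly[of _ _ 1, simplified] power_mult [symmetric] mult.commute)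
  then show ?thesis
    by (simp add: carlitz_D_def prod.lessThan_Suc_shift del: prod.lessThan_Suc)
qed

lemma carlitz_L_pow:
  "(carlitz_L d :: 'a::{field,finite} poly) ^ (CARD('a) ^ i) =
    (\<Prod>j=1..d. theta ^ (CARD('a) ^ i) - theta ^ (CARD('a) ^ (i + j)))"
  unfolding carlitz_L_def prod_power_distrib diff_pow_card_poly
  by (simp add: power_mult [symmetric] power_add mult.commute)

lemma carlitz_L_Suc_pow:
  "(carlitz_L (Suc d) :: 'a::{field,finite} poly) ^ (CARD('a) ^ i) =
    (theta ^ (CARD('a) ^ i) - theta ^ (CARD('a) ^ (i + Suc d))) * carlitz_L d ^ (CARD('a) ^ i)"
  unfolding carlitz_L_pow by simp

text \<open>
  With $e_d(x) = \prod_{\deg a < d} (x - a)$, these are the coefficients of $e_d(x) / D_d$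
  at $x^{q^i}$.
\<close>

definition carlitz_coeff :: "nat \<Rightarrow> nat \<Rightarrow> 'a::{field,finite} poly fract" where
  "carlitz_coeff d i = 1 / to_fract (carlitz_D i * carlitz_L (d - i) ^ (CARD('a) ^ i))"

text \<open>The index d - i is unchanged, so the L part is simply raised to the q-th power;
  \<open>carlitz_D_Suc\<close> accounts for the extra factor.\<close>

lemma carlitz_coeff_Suc_Suc:
  "to_fract (theta ^ (CARD('a) ^ Suc i) - theta) * carlitz_coeff (Suc d) (Suc i)
    = (carlitz_coeff d i :: 'a::{field,finite} poly fract) ^ CARD('a)"
proof -
  have "theta ^ (CARD('a) ^ Suc i) - (theta :: 'a poly) \<noteq> 0"
    using theta_pow_card_inj[of "Suc i" 0, where 'a='a] by simp
  then have "to_fract (theta ^ (CARD('a) ^ Suc i) - theta) \<noteq> (0 :: 'a poly fract)"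
    unfolding to_fract_eq_0_iff .
  then show ?thesis
    unfolding carlitz_coeff_def carlitz_D_Suc
    by (simp add: power_mult_distrib power_one_over power_mult [symmetric] mult.commute
          del: to_fract_diff)
qed

text \<open>Here D_i stays fixed, and L_{d+1-i} has one factor more than L_{d-i}; the q^i-th power
  of that factor is the one on the left.\<close>

lemma carlitz_coeff_Suc:
  assumes "i \<le> d"
  shows "to_fract (theta ^ (CARD('a) ^ i) - theta ^ (CARD('a) ^ Suc d)) * carlitz_coeff (Suc d) i
    = (carlitz_coeff d i :: 'a::{field,finite} poly fract)"
proof -
  have "theta ^ (CARD('a) ^ i) - (theta :: 'a poly) ^ (CARD('a) ^ Suc d) \<noteq> 0"
    using theta_pow_card_inj[of i "Suc d", where 'a='a] assms by simp
  then have "to_fract (theta ^ (CARD('a) ^ i) - theta ^ (CARD('a) ^ Suc d)) \<noteq> (0 :: 'a poly fract)"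
    unfolding to_fract_eq_0_iff .
  moreover have "(carlitz_L (Suc d - i) :: 'a poly) ^ (CARD('a) ^ i) =
      (theta ^ (CARD('a) ^ i) - theta ^ (CARD('a) ^ Suc d)) * carlitz_L (d - i) ^ (CARD('a) ^ i)"
    using carlitz_L_Suc_pow[of "d - i" i, where 'a='a] assms by (simp add: Suc_diff_le)
  ultimately show ?thesis
    unfolding carlitz_coeff_def by (simp only: to_fract_mult) simp
qed

section \<open>The additive functions E_d\<close>

definition carlitz_E :: "nat \<Rightarrow> 'a::{field,finite} poly fract \<Rightarrow> 'a poly fract" where
  "carlitz_E d x = (\<Sum>i\<le>d. carlitz_coeff d i * x ^ (CARD('a) ^ i))"

lemma carlitz_E_add: "carlitz_E d (x + y) = carlitz_E d x + carlitz_E d y"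
  by (simp add: carlitz_E_def add_pow_card_fract algebra_simps sum.distrib)

lemma carlitz_E_theta_mult:
  fixes x :: "'a::{field,finite} poly fract"
  shows "carlitz_E (Suc d) (to_fract theta * x)
    = to_fract theta * carlitz_E (Suc d) x + carlitz_E d x ^ CARD('a)"
proof -
  have "carlitz_E (Suc d) (to_fract theta * x) - to_fract theta * carlitz_E (Suc d) x
    = (\<Sum>i\<le>Suc d. to_fract (theta ^ (CARD('a) ^ i) - theta) * carlitz_coeff (Suc d) i * x ^ (CARD('a) ^ i))"
    unfolding carlitz_E_def sum_distrib_left sum_subtractf[symmetric]
    by (intro sum.cong) (simp_all add: algebra_simps power_mult_distrib)
  \<comment> \<open>The term i = 0 vanishes because theta^(q^0) = theta; the others are shifted down
    by one.\<close>
  also have "\<dots> = (\<Sum>i\<le>d. carlitz_coeff d i ^ CARD('a) * x ^ (CARD('a) ^ Suc i))"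
    unfolding sum.atMost_Suc_shift carlitz_coeff_Suc_Suc by simp
  also have "\<dots> = carlitz_E d x ^ CARD('a)"
    unfolding carlitz_E_def
    by (simp add: sum_pow_card_fract[of _ _ 1, simplified] power_mult_distrib power_mult [symmetric] mult.commute)
  finally show ?thesis by (simp add: algebra_simps)
qed

lemma carlitz_E_theta_mult':
  fixes x :: "'a::{field,finite} poly fract"
  shows "carlitz_E (Suc d) (to_fract theta * x)
    = to_fract theta ^ (CARD('a) ^ Suc d) * carlitz_E (Suc d) x + carlitz_E d x"
proof -
  have "carlitz_E (Suc d) (to_fract theta * x)
      - to_fract theta ^ (CARD('a) ^ Suc d) * carlitz_E (Suc d) x
    = (\<Sum>i\<le>Suc d. to_fract (theta ^ (CARD('a) ^ i) - theta ^ (CARD('a) ^ Suc d))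
        * carlitz_coeff (Suc d) i * x ^ (CARD('a) ^ i))"
    unfolding carlitz_E_def sum_distrib_left sum_subtractf[symmetric]
    by (intro sum.cong) (simp_all add: algebra_simps power_mult_distrib)
  \<comment> \<open>This time the top term i = d + 1 vanishes.\<close>
  also have "\<dots> = (\<Sum>i\<le>d. carlitz_coeff d i * x ^ (CARD('a) ^ i))"
    unfolding sum.atMost_Suc using carlitz_coeff_Suc[of _ d, where 'a='a] by simp
  finally show ?thesis by (simp add: algebra_simps carlitz_E_def)
qed

text \<open>
  Comparing the two expressions for $E_{d+1}(\theta x)$ shows that
  $(\theta^{q^{d+1}} - \theta) E_{d+1}(x) = E_d(x)^q - E_d(x)$, which vanishes if $E_d(x) \in \mathbb{F}_q$.
\<close>

lemma carlitz_E_to_fract: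
  fixes a :: "'a::{field,finite} poly"
  assumes "degree a \<le> d"
  shows "carlitz_E d (to_fract a) = to_fract [:coeff a d:]"
  using assms
proof (induction d arbitrary: a)
  case 0
  then obtain c where "a = [:c:]" by (auto elim: degree_eq_zeroE)
  then show ?case
    by (simp add: carlitz_E_def carlitz_coeff_def carlitz_D_def carlitz_L_def)
next
  case (Suc d)
  have const_pow: "to_fract [:c :: 'a:] ^ CARD('a) = to_fract [:c:]" for c
  proof -
    have "[:c:] ^ CARD('a) = [:c :: 'a:]"
      by (simp add: poly_const_pow finite_field_pow_card)
    then show ?thesis by (metis to_fract_power)
  qed
  have small: "carlitz_E (Suc d) (to_fract b) = 0" if b: "degree b \<le> d" for b :: "'a poly"
  proof -
    have "(to_fract theta ^ (CARD('a) ^ Suc d) - to_fract theta) * carlitz_E (Suc d) (to_fract b) = 0"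
      using carlitz_E_theta_mult[of d "to_fract b"] carlitz_E_theta_mult'[of d "to_fract b"]
      unfolding Suc.IH[OF b] const_pow by (simp add: algebra_simps)
    moreover have "to_fract theta ^ (CARD('a) ^ Suc d) - to_fract theta
      = to_fract (theta ^ (CARD('a) ^ Suc d) - theta :: 'a poly)" by simp
    moreover have "theta ^ (CARD('a) ^ Suc d) - theta \<noteq> (0 :: 'a poly)"
      using theta_pow_card_inj[of "Suc d" 0, where 'a='a] by simp
    ultimately show ?thesis by (simp only: mult_eq_0_iff to_fract_eq_0_iff) blast
  qed
  obtain c b where a: "a = pCons c b" by (cases a)
  then have b: "degree b \<le> d" using Suc.prems by (auto split: if_splits)
  \<comment> \<open>By additivity and \<open>carlitz_E_theta_mult\<close> the value at a is
    E_d(b)^q, since E_{d+1} vanishes at c and at b by \<open>small\<close>; and E_d(b) is the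
    leading entry of a.\<close>
  have "a = [:c:] + theta * b"
    by (simp add: a theta_def monom_altdef)
  then have "carlitz_E (Suc d) (to_fract a)
    = carlitz_E (Suc d) (to_fract [:c:]) + carlitz_E (Suc d) (to_fract theta * to_fract b)"
    by (simp only: to_fract_add to_fract_mult carlitz_E_add)
  also have "\<dots> = to_fract [:coeff b d:]"
    unfolding carlitz_E_theta_mult small[OF b] Suc.IH[OF b] const_pow
    by (simp add: small)
  finally show ?case by (simp add: a)
qed

section \<open>Power sums\<close>

definition monics :: "nat \<Rightarrow> 'a::{field,finite} poly set" where
  "monics d = {a. monic a \<and> degree a = d}"

lemma finite_monics: "finite (monics d :: 'a::{field,finite} poly set)"
  by (rule finite_subset[OF _ finite_degree_le[of d]]) (auto simp: monics_def)

lemma card_monics: "card (monics d :: 'a::{field,finite} poly set) = CARD('a) ^ d"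
proof -
  \<comment> \<open>A monic polynomial of degree d corresponds to the list of its d lower
    coefficients, to which the entry 1 is appended.\<close>
  have "bij_betw (\<lambda>xs. Poly (xs @ [1])) {xs :: 'a list. length xs = d} (monics d)"
  proof (rule bij_betw_byWitness[where f' = "\<lambda>a. butlast (coeffs a)"])
    have coeffs: "coeffs (Poly (xs @ [1 :: 'a])) = xs @ [1]" for xs :: "'a list"
      by (simp del: Poly_append)
    show "\<forall>xs\<in>{xs. length xs = d}. butlast (coeffs (Poly (xs @ [1 :: 'a]))) = xs"
      by (simp add: coeffs del: Poly_append)
    show "(\<lambda>xs. Poly (xs @ [1])) ` {xs. length xs = d} \<subseteq> (monics d :: 'a poly set)"
    proof safe
      fix xs :: "'a list" assume "d = length xs"
      moreover have "Poly (xs @ [1]) \<noteq> 0" using coeffs[of xs] by (metis coeffs_0_eq_Nil snoc_eq_iff_butlast)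
      ultimately show "Poly (xs @ [1]) \<in> monics (length xs)"
        by (simp add: monics_def degree_eq_length_coeffs nth_default_append coeffs del: Poly_append)
    qed
    have snoc: "butlast (coeffs a) @ [1] = coeffs a" if "monic a" for a :: "'a poly"
      using that last_coeffs_eq_coeff_degree[of a] by (metis append_butlast_last_id coeffs_eq_Nil leading_coeff_0_iff zero_neq_one)
    have "Poly (butlast (coeffs a) @ [1]) = a" if "monic a" for a :: "'a poly"
      by (simp only: snoc[OF that] Poly_coeffs)
    then show "\<forall>a\<in>monics d. Poly (butlast (coeffs a) @ [1]) = (a :: 'a poly)"
      unfolding monics_def by blast
    show "(\<lambda>a. butlast (coeffs a)) ` (monics d :: 'a poly set) \<subseteq> {xs. length xs = d}"
      by (auto simp: monics_def degree_eq_length_coeffs)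
  qed
  then have "card (monics d :: 'a poly set) = card {xs :: 'a list. length xs = d}"
    by (rule bij_betw_same_card[symmetric])
  then show ?thesis using card_lists_length_eq[of "UNIV :: 'a set" d] by simp
qed

section \<open>The product over the monic polynomials of degree d\<close>

definition carlitz_E_poly :: "nat \<Rightarrow> 'a::{field,finite} poly fract poly" where
  "carlitz_E_poly d = (\<Sum>i\<le>d. monom (carlitz_coeff d i) (CARD('a) ^ i))"

lemma carlitz_coeff_self: "carlitz_coeff d d = 1 / to_fract (carlitz_D d)"
  by (simp add: carlitz_coeff_def carlitz_L_def)

lemma carlitz_coeff_0: "carlitz_coeff d 0 = 1 / to_fract (carlitz_L d)"
  by (simp add: carlitz_coeff_def carlitz_D_def)

text \<open>Both sides have degree at most q^d and coefficient 1 at q^d, so agreement at the q^d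
  monic polynomials of degree d suffices. The left side vanishes there, and so does the right side
  because E_d takes the value 1 by \<open>carlitz_E_to_fract\<close>.\<close>

lemma prod_monics_eq:
  "(\<Prod>a\<in>monics d. [:- to_fract a, 1:]) =
    smult (to_fract (carlitz_D d)) (carlitz_E_poly d - 1 :: 'a::{field,finite} poly fract poly)"
  (is "?M = smult ?D ?F")
proof (rule poly_eqI_degree_lead_coeff[where n = "CARD('a) ^ d" and A = "to_fract ` monics d"])
  have D: "?D \<noteq> 0" by (simp add: carlitz_D_nonzero)
  have "degree ?M = (\<Sum>a\<in>monics d. degree [:- to_fract (a :: 'a poly), 1:])"
    by (rule degree_prod_eq_sum_degree) auto
  then have degM: "degree ?M = CARD('a) ^ d" by (simp add: card_monics)
  have "lead_coeff ?M = 1" by (simp add: lead_coeff_prod)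
  then have 1: "coeff ?M (CARD('a) ^ d) = 1" by (simp add: degM)
  have "CARD('a) ^ i = CARD('a) ^ j \<longleftrightarrow> i = j" for i j
    using card_field_gt_1[where 'a='a] by (rule power_inject_exp)
  then have "coeff (carlitz_E_poly d) (CARD('a) ^ d) = (carlitz_coeff d d :: 'a poly fract)"
    by (simp add: carlitz_E_poly_def coeff_sum)
  then show "coeff ?M (CARD('a) ^ d) = coeff (smult ?D ?F) (CARD('a) ^ d)"
    using D by (simp add: 1 carlitz_coeff_self coeff_1)
  show "CARD('a) ^ d \<le> card (to_fract ` (monics d :: 'a poly set))"
    by (simp add: card_image inj_on_def card_monics)
  show "degree ?M \<le> CARD('a) ^ d" by (simp add: degM)
  have "degree (monom (carlitz_coeff d i :: 'a poly fract) (CARD('a) ^ i)) \<le> CARD('a) ^ d"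
    if "i \<le> d" for i
  proof -
    have "CARD('a) ^ i \<le> CARD('a) ^ d" using that by (intro power_increasing) simp_all
    with degree_monom_le show ?thesis by (rule order_trans)
  qed
  then have "degree (carlitz_E_poly d :: 'a poly fract poly) \<le> CARD('a) ^ d"
    unfolding carlitz_E_poly_def by (intro degree_sum_le) auto
  then have "degree ?F \<le> CARD('a) ^ d" by (intro degree_diff_le) auto
  then show "degree (smult ?D ?F) \<le> CARD('a) ^ d" by (meson degree_smult_le order_trans)
next
  fix z :: "'a poly fract" assume "z \<in> to_fract ` monics d"
  then obtain a where a: "a \<in> monics d" "z = to_fract a" by blast
  have "poly ?M z = 0" using a finite_monics[of d, where 'a='a] by (simp add: poly_prod prod_zero_iff)
  moreover have "poly (carlitz_E_poly d) z = carlitz_E d z"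
    by (simp add: carlitz_E_poly_def carlitz_E_def poly_sum poly_monom)
  moreover have "carlitz_E d z = 1"
  proof -
    have "coeff a d = 1" "degree a \<le> d" using a(1) by (auto simp: monics_def)
    then show ?thesis using carlitz_E_to_fract[of a d] a(2) by (simp add: one_pCons [symmetric])
  qed
  ultimately show "poly ?M z = poly (smult ?D ?F) z" by simp
qed

text \<open>Since q = 0 in k, every term X^(q^i) with i > 0 has derivative 0, and only the linear
  term is left.\<close>

lemma pderiv_carlitz_E_poly:
  "pderiv (carlitz_E_poly d) = [:1 / to_fract (carlitz_L d) :: 'a::{field,finite} poly fract:]"
proof -
  have "to_fract (of_nat CARD('a) :: 'a poly) = 0"
    by (simp add: of_nat_poly of_nat_card_eq_0)
  then have q: "of_nat CARD('a) = (0 :: 'a poly fract)" by (simp only: to_fract_of_nat)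
  have "pderiv (carlitz_E_poly d :: 'a poly fract poly)
    = (\<Sum>i\<le>d. if i = 0 then [:carlitz_coeff d 0:] else 0)"
    unfolding carlitz_E_poly_def higher_pderiv_sum[of 1, simplified]
    by (intro sum.cong) (auto simp: pderiv_monom q power_0_left monom_0)
  then show ?thesis by (simp add: carlitz_coeff_0)
qed

section \<open>The generating series of the power sums\<close>

definition monic_power_sum :: "nat \<Rightarrow> nat \<Rightarrow> 'a::{field,finite} poly fract" where
  "monic_power_sum d n = (\<Sum>a\<in>monics d. 1 / to_fract a ^ n)"

text \<open>
  The logarithmic derivative of $\prod_a (X - a)$ generates the power sums; its numerator is
  constant because $e_d$ is $\mathbb{F}_q$-linear.
\<close>

lemma monic_power_sum_fps:
  "(1 - fps_of_poly (carlitz_E_poly d)) * Abs_fps (\<lambda>n. monic_power_sum d (Suc n)) =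
    fps_const (1 / to_fract (carlitz_L d) :: 'a::{field,finite} poly fract)"
proof -
  let ?D = "to_fract (carlitz_D d) :: 'a poly fract"
  let ?E = "carlitz_E_poly d :: 'a poly fract poly"
  define X where "X a = [:- to_fract a, 1:]" for a :: "'a poly"
  \<comment> \<open>The geometric series of 1 / (a - x); hence its product with x - a is -1.\<close>
  define g where "g a = Abs_fps (\<lambda>n. 1 / to_fract a ^ Suc n)" for a :: "'a poly"
  define M where "M = (\<Prod>a\<in>monics d. X a)"
  have Xg: "fps_of_poly (X a) * g a = - 1" if "a \<in> monics d" for a
  proof -
    have "a \<noteq> 0" using that by (auto simp: monics_def)
    have "fps_of_poly (X a) = fps_X - fps_const (to_fract a)"
      by (rule fps_ext) (auto simp: X_def fps_X_def coeff_pCons split: nat.splits)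
    then have *: "fps_of_poly (X a) * g a = fps_X * g a - fps_const (to_fract a) * g a"
      by (simp only: left_diff_distrib)
    show ?thesis
    proof (rule fps_ext)
      fix n
      show "fps_nth (fps_of_poly (X a) * g a) n = fps_nth (- 1) n"
        unfolding * using \<open>a \<noteq> 0\<close> by (cases n) (simp_all add: g_def)
    qed
  qed
  have G: "Abs_fps (\<lambda>n. monic_power_sum d (Suc n)) = (\<Sum>a\<in>monics d. g a)"
    by (rule fps_ext) (simp add: fps_sum_nth g_def monic_power_sum_def)
  have "fps_of_poly M * (\<Sum>a\<in>monics d. g a) = (\<Sum>a\<in>monics d. fps_of_poly M * g a)"
    by (rule sum_distrib_left)
  also have "\<dots> = (\<Sum>a\<in>monics d. - fps_of_poly (\<Prod>b\<in>monics d - {a}. X b))"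
  proof (rule sum.cong)
    fix a :: "'a poly" assume a: "a \<in> monics d"
    \<comment> \<open>Multiplication by \<open>g a\<close> removes the factor \<open>X a\<close> and
      changes the sign.\<close>
    have "M = (\<Prod>b\<in>monics d - {a}. X b) * X a"
      unfolding M_def using prod.remove[OF finite_monics a, of X] by (simp add: mult.commute)
    then show "fps_of_poly M * g a = - fps_of_poly (\<Prod>b\<in>monics d - {a}. X b)"
      by (simp add: fps_of_poly_mult mult.assoc Xg[OF a])
  qed simp
  \<comment> \<open>The inserted factors \<open>pderiv (X a)\<close> are 1; with them the sum is the
    product rule for \<open>M\<close>.\<close>
  also have "\<dots> = - fps_of_poly (\<Sum>a\<in>monics d. (\<Prod>b\<in>monics d - {a}. X b) * pderiv (X a))"
    by (simp add: X_def pderiv_pCons fps_of_poly_sum sum_negf one_pCons [symmetric])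
  also have "\<dots> = - fps_of_poly (pderiv M)"
    by (simp only: M_def pderiv_prod)
  also have "pderiv M = smult ?D [:1 / to_fract (carlitz_L d):]"
    unfolding M_def X_def prod_monics_eq pderiv_smult pderiv_diff pderiv_carlitz_E_poly by simp
  also have "- fps_of_poly \<dots> = fps_const (- ?D) * fps_const (1 / to_fract (carlitz_L d))"
    by (simp add: fps_of_poly_smult)
  finally have "fps_const (- ?D) * ((1 - fps_of_poly ?E) * (\<Sum>a\<in>monics d. g a))
      = fps_const (- ?D) * fps_const (1 / to_fract (carlitz_L d))"
    unfolding M_def X_def prod_monics_eq
    by (simp add: fps_of_poly_smult fps_of_poly_diff algebra_simps flip: fps_const_neg)
  moreover have "fps_const (- ?D) \<noteq> 0" by (simp add: carlitz_D_nonzero)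
  ultimately show ?thesis unfolding G by (simp only: mult_cancel_left) simp
qed

text \<open>Obtained by comparing coefficients of x^n in \<open>monic_power_sum_fps\<close>. In this
  form it can be matched with the recursion for the Anderson--Thakur polynomials.\<close>

lemma monic_power_sum_rec:
  "monic_power_sum d (Suc n) = (\<Sum>i\<in>{i. i \<le> d \<and> CARD('a) ^ i \<le> n}.
      carlitz_coeff d i * monic_power_sum d (Suc (n - CARD('a) ^ i)))
    + (if n = 0 then 1 / to_fract (carlitz_L d) else 0 :: 'a::{field,finite} poly fract)"
proof -
  let ?S = "Abs_fps (\<lambda>n. monic_power_sum d (Suc n)) :: 'a poly fract fps"
  have "fps_nth (fps_of_poly (carlitz_E_poly d) * ?S) n
    = (\<Sum>i\<le>d. if CARD('a) ^ i \<le> n then carlitz_coeff d i * monic_power_sum d (Suc (n - CARD('a) ^ i)) else 0)"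
    unfolding carlitz_E_poly_def fps_of_poly_sum sum_distrib_right fps_sum_nth
    by (intro sum.cong) (auto simp: fps_of_poly_monom mult.assoc fps_X_power_mult_nth)
  also have "\<dots> = (\<Sum>i\<in>{i. i \<le> d \<and> CARD('a) ^ i \<le> n}.
      carlitz_coeff d i * monic_power_sum d (Suc (n - CARD('a) ^ i)))"
    by (simp add: sum.inter_filter [symmetric])
  moreover have "fps_nth ((1 - fps_of_poly (carlitz_E_poly d)) * ?S) n
    = monic_power_sum d (Suc n) - fps_nth (fps_of_poly (carlitz_E_poly d) * ?S) n"
    by (simp add: left_diff_distrib)
  ultimately show ?thesis unfolding monic_power_sum_fps by (simp add: algebra_simps split: if_splits)
qed

section \<open>Carlitz factorials\<close>

text \<open>Digits at positions i > n vanish as n < q^i. The free bound \<open>N\<close> allows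
  factorials of different numbers to be compared over one range.\<close>

lemma carlitz_gamma_Suc:
  assumes "n < N"
  shows "carlitz_gamma (Suc n) =
    (\<Prod>i<N. carlitz_D i ^ (n div CARD('a) ^ i mod CARD('a)) :: 'a::{field,finite} poly)"
proof -
  have "n div CARD('a) ^ i = 0" if "n < i" for i
  proof -
    have "i < CARD('a) ^ i" using card_field_gt_1[where 'a='a] by (simp add: power_gt_expt)
    with that show ?thesis by simp
  qed
  then show ?thesis
    unfolding carlitz_gamma_def diff_Suc_1 using assms
    by (intro prod.mono_neutral_left) auto
qed

lemma carlitz_gamma_nonzero: "carlitz_gamma n \<noteq> 0"
  by (simp add: carlitz_gamma_def carlitz_D_nonzero)

text \<open>There is no carry, so adding c q^i changes only the digit at position i.\<close>

lemma carlitz_gamma_add_digit: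
  assumes "m div CARD('a) ^ i mod CARD('a) + c < CARD('a)"
  shows "carlitz_gamma (Suc (m + c * CARD('a) ^ i)) =
    carlitz_D i ^ c * (carlitz_gamma (Suc m) :: 'a::{field,finite} poly)"
proof -
  define q where "q = CARD('a)"
  have q: "q > 1" unfolding q_def by (rule card_field_gt_1)
  note c = assms[folded q_def]
  \<comment> \<open>Large enough for the digits of both m and m + c q^i, and for the range to
    contain i.\<close>
  define N where "N = Suc (m + c * q ^ i + i)"
  have shift: "(m + c * q ^ i) div q ^ i = m div q ^ i + c" using q by simp
  have digit: "(m + c * q ^ i) div q ^ j mod q = (m div q ^ j mod q) + (if j = i then c else 0)" for j
  proof (cases j i rule: linorder_cases)
    case less
    then have "q ^ i = q ^ j * (q * q ^ (i - Suc j))"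
      by (simp flip: power_Suc power_add)
    then have "m + c * q ^ i = m + (q * (c * q ^ (i - Suc j))) * q ^ j" by (simp only: mult_ac)
    then have "(m + c * q ^ i) div q ^ j = q * (c * q ^ (i - Suc j)) + m div q ^ j"
      using div_mult_self1[of "q ^ j" m "q * (c * q ^ (i - Suc j))"] q
      by (metis not_one_less_zero power_not_zero)
    then show ?thesis using less by simp
  next
    case equal
    have "(m div q ^ i + c) mod q = m div q ^ i mod q + c"
      using mod_less[OF c] by (simp only: mod_add_left_eq)
    then show ?thesis unfolding equal shift by simp
  next
    case greater
    then have j: "q ^ j = q ^ i * (q * q ^ (j - Suc i))"
      by (simp flip: power_Suc power_add)
    have "m div q ^ i + c = (m div q ^ i mod q + c) + (m div q ^ i div q) * q"
      using mod_mult_div_eq[of "m div q ^ i" q] by simp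
    also have "\<dots> div q = m div q ^ i div q"
      using div_less[OF c] q by (subst div_mult_self1) auto
    finally have "(m div q ^ i + c) div q = m div q ^ i div q" .
    then have "(m + c * q ^ i) div q ^ j = m div q ^ j"
      unfolding j div_mult2_eq shift by simp
    then show ?thesis using greater by simp
  qed
  have "carlitz_gamma (Suc (m + c * q ^ i))
      = (\<Prod>j<N. carlitz_D j ^ ((m + c * q ^ i) div q ^ j mod q) :: 'a poly)"
    unfolding q_def by (rule carlitz_gamma_Suc) (simp add: N_def q_def)
  also have "\<dots> = (\<Prod>j<N. carlitz_D j ^ (m div q ^ j mod q) * (if j = i then carlitz_D i ^ c else 1))"
    unfolding digit by (intro prod.cong) (auto simp: power_add)
  also have "\<dots> = carlitz_gamma (Suc m) * carlitz_D i ^ c"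
    using carlitz_gamma_Suc[of m N, where 'a='a]
    by (simp add: prod.distrib N_def q_def)
  finally show ?thesis by (simp add: q_def mult.commute)
qed

text \<open>A carry at position \<open>i\<close> is absorbed by $D_i^q \mid D_{i+1}$.\<close>

lemma carlitz_D_mult_gamma_dvd:
  "carlitz_D i * carlitz_gamma (Suc m) dvd
    (carlitz_gamma (Suc (m + CARD('a) ^ i)) :: 'a::{field,finite} poly)"
proof (induction m arbitrary: i rule: less_induct)
  case (less m)
  define q where "q = CARD('a)"
  have q: "q > 1" unfolding q_def by (rule card_field_gt_1)
  show ?case
  proof (cases "m div q ^ i mod q + 1 < q")
    case True
    then show ?thesis using carlitz_gamma_add_digit[of m i 1, where 'a='a] by (simp add: q_def)
  next
    case False
    moreover have "m div q ^ i mod q < q" using q by simp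
    ultimately have digit: "m div q ^ i mod q = q - 1" by linarith
    \<comment> \<open>Clearing the digit q - 1 at position i gives m + q^i = m' + q^(i+1), so the
      carry is handled by the induction hypothesis for m' at position i + 1.\<close>
    define m' where "m' = m - (q - 1) * q ^ i"
    have le: "(q - 1) * q ^ i \<le> m"
    proof -
      have "q - 1 \<le> m div q ^ i" using digit by (metis mod_less_eq_dividend)
      then have "(q - 1) * q ^ i \<le> m div q ^ i * q ^ i" by (rule mult_le_mono1)
      also have "\<dots> \<le> m" by simp
      finally show ?thesis .
    qed
    then have m: "m = m' + (q - 1) * q ^ i" by (simp add: m'_def)
    have "m' < m" using q unfolding m by simp
    have "m' div q ^ i mod q = 0"
    proof -
      have "(m' div q ^ i + (q - 1)) mod q = q - 1"
        using digit q unfolding m by (simp add: add.commute)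
      then have "(m' div q ^ i + (q - 1) + 1) mod q = (q - 1 + 1) mod q" by (metis mod_add_left_eq)
      then show ?thesis using q by simp
    qed
    then have gm: "carlitz_gamma (Suc m) = carlitz_D i ^ (q - 1) * (carlitz_gamma (Suc m') :: 'a poly)"
      using q unfolding m q_def by (intro carlitz_gamma_add_digit) simp
    have "carlitz_D i * carlitz_gamma (Suc m) = carlitz_D i ^ q * (carlitz_gamma (Suc m') :: 'a poly)"
      unfolding gm using q by (simp add: power_eq_if)
    also have "\<dots> dvd carlitz_D (Suc i) * carlitz_gamma (Suc m')"
      by (rule mult_dvd_mono) (simp_all add: carlitz_D_Suc q_def)
    also have "\<dots> dvd carlitz_gamma (Suc (m' + q ^ Suc i))"
      using less.IH[OF \<open>m' < m\<close>, of "Suc i"] by (simp add: q_def)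
    also have "m' + q ^ Suc i = m + q ^ i"
      using q unfolding m by (cases q) simp_all
    finally show ?thesis by (simp add: q_def)
  qed
qed

text \<open>The division is exact when q^i \<le> n, by \<open>carlitz_D_mult_gamma_dvd\<close>; this
  is the integrality that places H_n in A[t].\<close>

definition gamma_quot :: "nat \<Rightarrow> nat \<Rightarrow> 'a::{field,finite} poly" where
  "gamma_quot n i = carlitz_gamma (Suc n) div (carlitz_D i * carlitz_gamma (Suc (n - CARD('a) ^ i)))"

lemma gamma_quot:
  assumes "CARD('a) ^ i \<le> n"
  shows "carlitz_gamma (Suc n) =
    gamma_quot n i * carlitz_D i * (carlitz_gamma (Suc (n - CARD('a) ^ i)) :: 'a::{field,finite} poly)"
proof -
  have "carlitz_D i * carlitz_gamma (Suc (n - CARD('a) ^ i)) dvd (carlitz_gamma (Suc n) :: 'a poly)"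
    using carlitz_D_mult_gamma_dvd[of i "n - CARD('a) ^ i", where 'a='a] assms by simp
  then show ?thesis
    unfolding gamma_quot_def mult.assoc by (rule dvd_div_mult_self[symmetric])
qed

section \<open>Anderson--Thakur polynomials\<close>

lemma map_poly_ring_hom_mult:
  fixes f :: "'a::comm_semiring_0 \<Rightarrow> 'b::comm_semiring_0"
  assumes 0: "f 0 = 0" and add: "\<And>x y. f (x + y) = f x + f y"
    and mult: "\<And>x y. f (x * y) = f x * f y"
  shows "map_poly f (p * q) = map_poly f p * map_poly f q"
proof -
  have "f (sum g A) = (\<Sum>x\<in>A. f (g x))" for g :: "nat \<Rightarrow> 'a" and A
    by (induction A rule: infinite_finite_induct) (simp_all add: 0 add)
  then show ?thesis
    by (intro poly_eqI) (simp add: coeff_map_poly 0 coeff_mult mult)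
qed

lemma at_t_mult: "at_t (p * q) = at_t p * at_t q"
  unfolding at_t_def by (rule map_poly_ring_hom_mult) simp_all

lemma at_t_eq_0_iff: "at_t p = 0 \<longleftrightarrow> p = 0"
  unfolding at_t_def by (rule map_poly_eq_0_iff) simp_all

lemma finite_card_pow_le: "finite {i. CARD('a::{field,finite}) ^ i \<le> n}"
proof (rule finite_subset)
  have "i < CARD('a) ^ i" for i using card_field_gt_1[where 'a='a] by (simp add: power_gt_expt)
  then show "{i. CARD('a) ^ i \<le> n} \<subseteq> {..n}"
    by (auto intro: order_trans less_imp_le)
qed simp

section \<open>Integrality and recursion of the Anderson--Thakur polynomials\<close>

abbreviation AT_coeff :: "nat \<Rightarrow> 'a::{field,finite} poly poly fract" where
  "AT_coeff n \<equiv> fps_nth (inverse (1 - AT_series)) n"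

text \<open>With F the defining series and R the inverse of 1 - F, this is the coefficient of x^n in
  R = 1 + F R.\<close>

lemma AT_coeff_rec:
  "(AT_coeff n :: 'a::{field,finite} poly poly fract) = (\<Sum>i\<in>{i. CARD('a) ^ i \<le> n}.
      to_fract (AT_G i [:theta:]) / to_fract (at_t (carlitz_D i)) * AT_coeff (n - CARD('a) ^ i))
    + (if n = 0 then 1 else 0)"
proof -
  define F :: "'a poly poly fract fps" where "F = AT_series"
  define R where "R = inverse (1 - F)"
  define f :: "nat \<Rightarrow> 'a poly poly fract" where
    "f i = to_fract (AT_G i [:theta:]) / to_fract (at_t (carlitz_D i))" for i
  have F: "fps_nth F m = (\<Sum>i\<in>{i. CARD('a) ^ i = m}. f i)" for m
    by (simp add: F_def AT_series_def f_def)
  \<comment> \<open>No power of q is 0, so F has constant term 0 and 1 - F is invertible.\<close>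
  have "fps_nth (1 - F) 0 \<noteq> 0" by (simp add: F)
  then have "(1 - F) * R = 1" unfolding R_def by (rule inverse_mult_eq_1')
  then have R: "R = 1 + F * R" by (simp add: algebra_simps)
  have "fps_nth (F * R) n = (\<Sum>m=0..n. \<Sum>i\<in>{i. CARD('a) ^ i = m}. f i * fps_nth R (n - m))"
    by (simp add: fps_mult_nth F sum_distrib_right)
  also have "\<dots> = (\<Sum>m=0..n. \<Sum>i\<in>{i\<in>{i. CARD('a) ^ i \<le> n}. CARD('a) ^ i = m}.
      f i * fps_nth R (n - CARD('a) ^ i))"
    by (intro sum.cong refl) auto
  also have "\<dots> = (\<Sum>i\<in>{i. CARD('a) ^ i \<le> n}. f i * fps_nth R (n - CARD('a) ^ i))"
    by (rule sum.group[OF finite_card_pow_le]) auto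
  finally have "fps_nth R n = (\<Sum>i\<in>{i. CARD('a) ^ i \<le> n}. f i * fps_nth R (n - CARD('a) ^ i))
      + (if n = 0 then 1 else 0)"
    by (subst R) simp
  then show ?thesis by (simp add: R_def F_def f_def)
qed

text \<open>The factors \<open>gamma_quot n i\<close> bring all terms of \<open>AT_coeff_rec\<close>
  over the common denominator Gamma_{n+1}(t). Assuming the form of the coefficients only below n
  makes this usable as an induction step.\<close>

lemma AT_coeff_step:
  fixes h :: "nat \<Rightarrow> 'a::{field,finite} poly poly"
  assumes "\<And>m. m < n \<Longrightarrow> AT_coeff m = to_fract (h m) / to_fract (at_t (carlitz_gamma (Suc m)))"
  shows "AT_coeff n = to_fract ((\<Sum>i\<in>{i. CARD('a) ^ i \<le> n}.
      AT_G i [:theta:] * h (n - CARD('a) ^ i) * at_t (gamma_quot n i)) + (if n = 0 then 1 else 0))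
    / to_fract (at_t (carlitz_gamma (Suc n)))"
proof -
  have "to_fract (AT_G i [:theta:]) / to_fract (at_t (carlitz_D i)) * AT_coeff (n - CARD('a) ^ i)
    = to_fract (AT_G i [:theta:] * h (n - CARD('a) ^ i) * at_t (gamma_quot n i))
      / to_fract (at_t (carlitz_gamma (Suc n)))" if i: "CARD('a) ^ i \<le> n" for i
  proof -
    have "n - CARD('a) ^ i < n" using i card_field_gt_1[where 'a='a] by (intro diff_less) (auto intro: less_le_trans[OF _ i])
    moreover have "gamma_quot n i \<noteq> (0 :: 'a poly)"
      using gamma_quot[OF i] carlitz_gamma_nonzero[of "Suc n", where 'a='a] by auto
    ultimately show ?thesis
      by (simp add: assms gamma_quot[OF i] at_t_mult at_t_eq_0_iff carlitz_D_nonzero)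
  qed
  moreover have "carlitz_gamma (Suc 0) = (1 :: 'a poly)" by (simp add: carlitz_gamma_def)
  moreover have "at_t 1 = (1 :: 'a poly poly)" by (simp add: at_t_def pCons_one)
  ultimately show ?thesis
    by (subst AT_coeff_rec) (simp add: add_divide_distrib sum_divide_distrib)
qed

lemma AT_H_eqI:
  fixes h :: "'a::{field,finite} poly poly"
  assumes "AT_coeff n = to_fract h / to_fract (at_t (carlitz_gamma (Suc n)))"
  shows "AT_H n = h"
  unfolding AT_H_def
proof (rule the_equality)
  fix h' :: "'a poly poly"
  assume "AT_coeff n = to_fract h' / to_fract (at_t (carlitz_gamma (n + 1)))"
  then show "h' = h" using assms by (simp add: at_t_eq_0_iff carlitz_gamma_nonzero)
qed (use assms in simp)

text \<open>The description in \<open>AT_H_def\<close> does have a solution in A[t]: by induction,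
  the numerator built in \<open>AT_coeff_step\<close> is one, and \<open>AT_H_eqI\<close> gives
  uniqueness.\<close>

lemma AT_coeff_eq:
  "AT_coeff n = to_fract (AT_H n :: 'a::{field,finite} poly poly) / to_fract (at_t (carlitz_gamma (Suc n)))"
proof (induction n rule: less_induct)
  case (less n)
  have "AT_H n = (\<Sum>i\<in>{i. CARD('a) ^ i \<le> n}. AT_G i [:theta:] * AT_H (n - CARD('a) ^ i)
      * at_t (gamma_quot n i)) + (if n = 0 then 1 else 0 :: 'a poly poly)"
    by (rule AT_H_eqI, rule AT_coeff_step, rule less)
  with AT_coeff_step[of n AT_H, OF less] show ?case by simp
qed

lemma AT_H_rec:
  "(AT_H n :: 'a::{field,finite} poly poly) = (\<Sum>i\<in>{i. CARD('a) ^ i \<le> n}.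
    AT_G i [:theta:] * AT_H (n - CARD('a) ^ i) * at_t (gamma_quot n i)) + (if n = 0 then 1 else 0)"
  by (rule AT_H_eqI, rule AT_coeff_step, rule AT_coeff_eq)

section \<open>Twisted evaluation at t = theta\<close>

text \<open>This is usually written $h^{(d)}(\theta)$, or $h^{(d)}|_{t = \theta}$.\<close>

definition twist_eval :: "nat \<Rightarrow> 'a::{field,finite} poly poly \<Rightarrow> 'a poly" where
  "twist_eval d h = poly (map_poly (\<lambda>c. c ^ (CARD('a) ^ d)) h) theta"

lemma twist_eval_add: "twist_eval d (g + h) = twist_eval d g + twist_eval d h"
proof -
  have "map_poly (\<lambda>c. c ^ (CARD('a) ^ d)) (g + h) =
    map_poly (\<lambda>c. c ^ (CARD('a) ^ d)) g + map_poly (\<lambda>c. c ^ (CARD('a) ^ d)) h"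
    by (intro poly_eqI) (simp add: coeff_map_poly add_pow_card_poly)
  then show ?thesis by (simp add: twist_eval_def)
qed

lemma twist_eval_mult: "twist_eval d (g * h) = twist_eval d g * twist_eval d h"
proof -
  have "map_poly (\<lambda>c. c ^ (CARD('a) ^ d)) (g * h) =
    map_poly (\<lambda>c. c ^ (CARD('a) ^ d)) g * map_poly (\<lambda>c. c ^ (CARD('a) ^ d)) h"
    by (rule map_poly_ring_hom_mult) (simp_all add: add_pow_card_poly power_mult_distrib)
  then show ?thesis by (simp add: twist_eval_def)
qed

lemma twist_eval_0 [simp]: "twist_eval d 0 = 0"
  and twist_eval_1 [simp]: "twist_eval d 1 = 1"
  by (simp_all add: twist_eval_def)

lemma twist_eval_sum: "twist_eval d (\<Sum>x\<in>S. f x) = (\<Sum>x\<in>S. twist_eval d (f x))"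
  by (induction S rule: infinite_finite_induct) (simp_all add: twist_eval_add)

lemma twist_eval_prod: "twist_eval d (\<Prod>x\<in>S. f x) = (\<Prod>x\<in>S. twist_eval d (f x))"
  by (induction S rule: infinite_finite_induct) (simp_all add: twist_eval_mult)

lemma twist_eval_power: "twist_eval d (g ^ n) = twist_eval d g ^ n"
  by (induction n) (simp_all add: twist_eval_mult)

lemma twist_eval_diff: "twist_eval d (g - h) = twist_eval d g - twist_eval d h"
  using twist_eval_add[of d "g - h" h] by simp

text \<open>The coefficients of \<open>at_t p\<close> are constants from the finite field, which the
  Frobenius fixes; setting t = theta then undoes the substitution.\<close>

lemma twist_eval_at_t: "twist_eval d (at_t p) = p"
proof (induction p)
  case (pCons c p)
  have "[:c:] ^ (CARD('a) ^ d) = [:c:]"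
    by (simp add: poly_const_pow finite_field_pow_card_pow)
  then show ?case using pCons
    by (simp add: at_t_def map_poly_pCons twist_eval_def theta_def monom_altdef)
qed (simp add: at_t_def)

text \<open>For h = H_{s-1} the summands are theta^j u_j^(q^d), which are the numerators occurring
  in the polylogarithms.\<close>

lemma twist_eval_altdef:
  "twist_eval d h = (\<Sum>j\<le>degree h. theta ^ j * coeff h j ^ (CARD('a) ^ d))"
  for h :: "'a::{field,finite} poly poly"
proof -
  have "degree (map_poly (\<lambda>c. c ^ (CARD('a) ^ d)) h) = degree h"
    by (rule degree_map_poly) simp
  then show ?thesis
    by (simp add: twist_eval_def poly_altdef coeff_map_poly mult.commute)
qed

lemma twist_eval_AT_G:
  "twist_eval d (AT_G i [:theta:]) =
    (\<Prod>j=1..i. theta ^ (CARD('a) ^ i) - theta ^ (CARD('a) ^ (d + j)) :: 'a::{field,finite} poly)"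
proof -
  have "twist_eval d (monom 1 m) = (theta ^ m :: 'a poly)" for m
    by (simp add: twist_eval_def map_poly_monom poly_monom)
  moreover have "twist_eval d [:theta:] = (theta ^ (CARD('a) ^ d) :: 'a poly)"
    by (simp add: twist_eval_def map_poly_pCons)
  ultimately show ?thesis
    by (simp add: AT_G_def twist_eval_prod twist_eval_diff twist_eval_power power_add
        flip: power_mult)
qed

text \<open>The factor with j = i - d is theta^(q^i) - theta^(q^i).\<close>

lemma twist_eval_AT_G_eq_0:
  assumes "d < i"
  shows "twist_eval d (AT_G i [:theta:]) = 0"
  unfolding twist_eval_AT_G using assms by (intro prod_zero bexI[of _ "i - d"]) auto

text \<open>All three terms are products of the same factors \<open>f j\<close>: j runs over 1..d -
  i for L_{d-i}^(q^i), over the remaining j up to d for the twisted G_i, and over 1..d for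
  L_d^(q^i).\<close>

lemma twist_eval_AT_G_mult:
  assumes "i \<le> d"
  shows "twist_eval d (AT_G i [:theta:]) * carlitz_L (d - i) ^ (CARD('a) ^ i) =
    (carlitz_L d ^ (CARD('a) ^ i) :: 'a::{field,finite} poly)"
proof -
  define f :: "nat \<Rightarrow> 'a poly" where "f j = theta ^ (CARD('a) ^ i) - theta ^ (CARD('a) ^ (i + j))" for j
  have "twist_eval d (AT_G i [:theta:]) = (\<Prod>j=1..i. f (j + (d - i)))"
    unfolding twist_eval_AT_G f_def using assms by (simp add: add.commute)
  also have "\<dots> = (\<Prod>j=1 + (d - i)..i + (d - i). f j)"
    by (rule prod.shift_bounds_cl_nat_ivl[symmetric])
  also have "\<dots> = (\<Prod>j=Suc (d - i)..d. f j)" using assms by simp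
  finally have "twist_eval d (AT_G i [:theta:]) * carlitz_L (d - i) ^ (CARD('a) ^ i)
      = (\<Prod>j=Suc (d - i)..d. f j) * (\<Prod>j=1..d - i. f j)"
    unfolding carlitz_L_pow f_def by simp
  also have "\<dots> = (\<Prod>j=1..d. f j)"
    using assms by (subst mult.commute, subst prod.union_disjoint[symmetric]) (auto intro!: prod.cong)
  finally show ?thesis unfolding carlitz_L_pow f_def .
qed

text \<open>Both sides satisfy the same recursion in n: \<open>AT_H_rec\<close> after twisting, and
  \<open>monic_power_sum_rec\<close> multiplied by L_d^(n+1).\<close>

lemma twist_eval_AT_H:
  "to_fract (twist_eval d (AT_H n)) / to_fract (carlitz_gamma (Suc n)) =
    to_fract (carlitz_L d) ^ Suc n * (monic_power_sum d (Suc n) :: 'a::{field,finite} poly fract)"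
proof (induction n rule: less_induct)
  case (less n)
  define L where "L = (to_fract (carlitz_L d) :: 'a poly fract)"
  have L: "L \<noteq> 0" by (simp add: L_def carlitz_L_nonzero)
  define I where "I = {i. CARD('a) ^ i \<le> n}"
  define T where "T i = to_fract (twist_eval d (AT_G i [:theta:]) :: 'a poly) / to_fract (carlitz_D i)
      * (L ^ Suc (n - CARD('a) ^ i) * monic_power_sum d (Suc (n - CARD('a) ^ i)))" for i
  have "to_fract (twist_eval d (AT_G i [:theta:] * AT_H (n - CARD('a) ^ i) * at_t (gamma_quot n i)))
      / to_fract (carlitz_gamma (Suc n)) = T i" if "i \<in> I" for i
  proof -
    have i: "CARD('a) ^ i \<le> n" using that by (simp add: I_def)
    have "n - CARD('a) ^ i < n" using i card_field_gt_1[where 'a='a] by (intro diff_less) (auto intro: less_le_trans[OF _ i])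
    then have "T i = to_fract (twist_eval d (AT_G i [:theta:])) / to_fract (carlitz_D i)
      * (to_fract (twist_eval d (AT_H (n - CARD('a) ^ i))) / to_fract (carlitz_gamma (Suc (n - CARD('a) ^ i))))"
      unfolding T_def L_def by (subst less.IH) simp_all
    moreover have "gamma_quot n i \<noteq> (0 :: 'a poly)"
      using gamma_quot[OF i] carlitz_gamma_nonzero[of "Suc n", where 'a='a] by auto
    ultimately show ?thesis
      by (simp add: gamma_quot[OF i] twist_eval_mult twist_eval_at_t)
  qed
  moreover have "carlitz_gamma (Suc 0) = (1 :: 'a poly)" by (simp add: carlitz_gamma_def)
  ultimately have "to_fract (twist_eval d (AT_H n)) / to_fract (carlitz_gamma (Suc n))
      = (\<Sum>i\<in>I. T i) + (if n = 0 then 1 else 0)"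
    by (subst AT_H_rec) (simp add: twist_eval_add twist_eval_sum add_divide_distrib
        sum_divide_distrib I_def)
  \<comment> \<open>Terms with i > d drop out because the twisted G_i is 0; this truncates the sum
    as in \<open>monic_power_sum_rec\<close>.\<close>
  also have "(\<Sum>i\<in>I. T i) = (\<Sum>i\<in>{i. i \<le> d \<and> CARD('a) ^ i \<le> n}. T i)"
    unfolding I_def by (rule sum.mono_neutral_right[OF finite_card_pow_le])
      (auto simp: T_def twist_eval_AT_G_eq_0)
  also have "\<dots> = (\<Sum>i\<in>{i. i \<le> d \<and> CARD('a) ^ i \<le> n}.
      L ^ Suc n * (carlitz_coeff d i * monic_power_sum d (Suc (n - CARD('a) ^ i))))"
  proof (rule sum.cong)
    fix i assume "i \<in> {i. i \<le> d \<and> CARD('a) ^ i \<le> n}"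
    then have i: "i \<le> d" "CARD('a) ^ i \<le> n" by auto
    have "to_fract (twist_eval d (AT_G i [:theta:])) * to_fract (carlitz_L (d - i) ^ (CARD('a) ^ i))
        = L ^ (CARD('a) ^ i)"
      unfolding L_def to_fract_power[symmetric] to_fract_mult[symmetric] twist_eval_AT_G_mult[OF i(1)] ..
    then have "to_fract (twist_eval d (AT_G i [:theta:]) :: 'a poly)
        = L ^ (CARD('a) ^ i) / to_fract (carlitz_L (d - i) ^ (CARD('a) ^ i))"
      by (simp add: field_simps carlitz_L_nonzero)
    then have "T i = (L ^ (CARD('a) ^ i) * L ^ Suc (n - CARD('a) ^ i))
        * (carlitz_coeff d i * monic_power_sum d (Suc (n - CARD('a) ^ i)))"
      by (simp add: T_def carlitz_coeff_def mult_ac)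
    also have "L ^ (CARD('a) ^ i) * L ^ Suc (n - CARD('a) ^ i) = L ^ Suc n"
      unfolding power_add[symmetric] using i(2) by simp
    finally show "T i = L ^ Suc n * (carlitz_coeff d i * monic_power_sum d (Suc (n - CARD('a) ^ i)))" .
  qed simp
  \<comment> \<open>For n = 0 the extra term 1 equals L_d times the term 1 / L_d of
    \<open>monic_power_sum_rec\<close>.\<close>
  also have "\<dots> + (if n = 0 then 1 else 0) = L ^ Suc n * monic_power_sum d (Suc n)"
    using L by (subst monic_power_sum_rec) (simp add: L_def [symmetric] sum_distrib_left algebra_simps)
  finally show ?case by (simp add: L_def)
qed

section \<open>The identity in $k$\<close>

text \<open>\<open>twist_eval_AT_H\<close> solved for the power sum, with the polynomial expanded in
  powers of t. Gamma_n goes with H_{n-1}, whence n \<ge> 1.\<close>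

lemma monic_power_sum_eq:
  assumes "1 \<le> n"
  shows "(monic_power_sum d n :: 'a::{field,finite} poly fract) =
    (\<Sum>j\<le>degree (AT_H (n - 1) :: 'a poly poly).
      to_fract theta ^ j * to_fract (coeff (AT_H (n - 1)) j) ^ (CARD('a) ^ d) / to_fract (carlitz_L d) ^ n)
    / to_fract (carlitz_gamma n)"
proof -
  obtain m where n: "n = Suc m" using assms by (cases n) auto
  have solve: "y = x / l / g" if "x / g = l * y" "l \<noteq> 0" "g \<noteq> 0" for x y l g :: "'a poly fract"
    using that by (auto simp: field_simps)
  have "(monic_power_sum d n :: 'a poly fract)
    = to_fract (twist_eval d (AT_H m)) / to_fract (carlitz_L d) ^ n / to_fract (carlitz_gamma n)"
    unfolding n by (rule solve[OF twist_eval_AT_H]) (simp_all add: carlitz_L_nonzero carlitz_gamma_nonzero)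
  then show ?thesis by (simp add: twist_eval_altdef n sum_divide_distrib)
qed

text \<open>Distributivity, a choice of one index per factor being encoded as a list. It serves both
  for tuples of monic polynomials and for the index set J.\<close>

lemma prod_sum_lists:
  fixes f :: "nat \<Rightarrow> 'b \<Rightarrow> 'c::comm_semiring_1"
  assumes "\<And>i. finite (A i)"
  shows "(\<Prod>i<n. \<Sum>x\<in>A i. f i x) =
    (\<Sum>xs\<in>{xs. length xs = n \<and> (\<forall>i<n. xs ! i \<in> A i)}. \<Prod>i<n. f i (xs ! i))"
proof (induction n)
  case (Suc n)
  let ?L = "\<lambda>n. {xs. length xs = n \<and> (\<forall>i<n. xs ! i \<in> A i)}"
  have "(\<Prod>i<Suc n. \<Sum>x\<in>A i. f i x) = (\<Sum>(xs, x)\<in>?L n \<times> A n. (\<Prod>i<n. f i (xs ! i)) * f n x)"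
    by (simp add: Suc sum_product sum.cartesian_product)
  also have "\<dots> = (\<Sum>xs\<in>?L (Suc n). \<Prod>i<Suc n. f i (xs ! i))"
  proof (rule sum.reindex_bij_witness[where j = "\<lambda>(xs, x). xs @ [x]" and i = "\<lambda>xs. (butlast xs, last xs)"])
    fix xs assume xs: "xs \<in> ?L (Suc n)"
    then have "xs \<noteq> []" by auto
    then show "(case (butlast xs, last xs) of (xs, x) \<Rightarrow> xs @ [x]) = xs" by simp
    show "(butlast xs, last xs) \<in> ?L n \<times> A n"
      using xs \<open>xs \<noteq> []\<close> by (auto simp: nth_butlast last_conv_nth)
  qed (auto simp: nth_append less_Suc_eq)
  finally show ?case .
qed simp

text \<open>The tuples are grouped by their degrees. Once the degrees are fixed, the entries vary
  independently over the monic polynomials, so each group gives a product of power sums.\<close>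

lemma zeta_sum_eq:
  "(\<Sum>xs\<in>zeta_index s (P :: 'a::{field,finite} poly). 1 / (\<Prod>i<length s. to_fract (xs ! i) ^ (s ! i))) =
    (\<Sum>is\<in>Li_index s P. \<Prod>l<length s. monic_power_sum (is ! l) (s ! l))"
proof -
  let ?f = "\<lambda>xs. \<Prod>i<length s. 1 / to_fract (xs ! i :: 'a poly) ^ (s ! i)"
  have "map degree ` zeta_index s P \<subseteq> Li_index s P"
    by (auto simp: zeta_index_def Li_index_def)
  then have "(\<Sum>xs\<in>zeta_index s P. ?f xs)
    = (\<Sum>is\<in>Li_index s P. \<Sum>xs\<in>{xs \<in> zeta_index s P. map degree xs = is}. ?f xs)"
    by (intro sum.group[symmetric] finite_zeta_index finite_Li_index)
  also have "\<dots> = (\<Sum>is\<in>Li_index s P. \<Prod>l<length s. monic_power_sum (is ! l) (s ! l))"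
  proof (rule sum.cong)
    fix "is" assume "is": "is \<in> Li_index s P"
    have "{xs \<in> zeta_index s P. map degree xs = is}
      = {xs. length xs = length s \<and> (\<forall>i<length s. xs ! i \<in> monics (is ! i))}"
    proof (intro set_eqI iffI)
      fix xs :: "'a poly list"
      assume "xs \<in> {xs. length xs = length s \<and> (\<forall>i<length s. xs ! i \<in> monics (is ! i))}"
      then have xs: "length xs = length s" "\<And>i. i < length s \<Longrightarrow> xs ! i \<in> monics (is ! i)" by auto
      then have deg: "map degree xs = is"
        using "is" by (auto simp: Li_index_def monics_def list_eq_iff_nth_eq)
      moreover have "xs \<in> zeta_index s P"
      proof -
        have "monic (xs ! i) \<and> degree (xs ! i) < degree P" if i: "i < length s" for i
          using xs(2)[OF i] "is" i unfolding Li_index_def monics_def by force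
        then show ?thesis
          using "is" xs(1) unfolding zeta_index_def Li_index_def mem_Collect_eq deg
          by (auto simp: in_set_conv_nth)
      qed
      ultimately show "xs \<in> {xs \<in> zeta_index s P. map degree xs = is}" by simp
    qed (auto simp: zeta_index_def monics_def)
    then show "(\<Sum>xs\<in>{xs \<in> zeta_index s P. map degree xs = is}. ?f xs)
      = (\<Prod>l<length s. monic_power_sum (is ! l) (s ! l))"
      unfolding monic_power_sum_def by (simp only: prod_sum_lists[OF finite_monics])
  qed simp
  finally show ?thesis by (simp add: prod_dividef)
qed

text \<open>The finite polylogarithm sum as an element of k; its residue is
  \<open>Li_Ak_at s (u_vec s js) P\<close>.\<close>

definition Li_sum :: "nat list \<Rightarrow> nat list \<Rightarrow> 'a::{field,finite} poly \<Rightarrow> 'a poly fract" where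
  "Li_sum s js P = (\<Sum>is\<in>Li_index s P. \<Prod>l<length s.
      (u_vec s js ! l) ^ (CARD('a) ^ (is ! l)) / to_fract (carlitz_L (is ! l)) ^ (s ! l))"

lemma J_index_eq: "J_index TYPE('a::{field,finite}) s = {js. length js = length s \<and>
    (\<forall>i<length s. js ! i \<in> {..degree (AT_H (s ! i - 1) :: 'a poly poly)})}"
  by (simp add: J_index_def)

text \<open>An equality in k, before any reduction: each product of power sums is expanded by
  \<open>monic_power_sum_eq\<close> and distributivity, and then the sums over degrees and over J
  are interchanged.\<close>

lemma zeta_sum_eq_Li_sum:
  fixes P :: "'a::{field,finite} poly"
  assumes "\<forall>n\<in>set s. 1 \<le> n"
  shows "(\<Sum>xs\<in>zeta_index s P. 1 / (\<Prod>i<length s. to_fract (xs ! i) ^ (s ! i))) =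
    1 / to_fract (Gamma_index s) * (\<Sum>js\<in>J_index TYPE('a) s. to_fract (poly (a_poly js) theta) * Li_sum s js P)"
proof -
  let ?u = "\<lambda>l j. to_fract (coeff (AT_H (s ! l - 1)) j) :: 'a poly fract"
  let ?L = "\<lambda>i. to_fract (carlitz_L i) :: 'a poly fract"
  have "(\<Prod>l<length s. monic_power_sum (is ! l) (s ! l)) =
    1 / to_fract (Gamma_index s) * (\<Sum>js\<in>J_index TYPE('a) s. to_fract (poly (a_poly js) theta)
      * (\<Prod>l<length s. (u_vec s js ! l) ^ (CARD('a) ^ (is ! l)) / ?L (is ! l) ^ (s ! l)))" for "is"
  proof -
    have "(\<Prod>l<length s. monic_power_sum (is ! l) (s ! l)) =
      (\<Prod>l<length s. (\<Sum>j\<in>{..degree (AT_H (s ! l - 1) :: 'a poly poly)}.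
        to_fract theta ^ j * ?u l j ^ (CARD('a) ^ (is ! l)) / ?L (is ! l) ^ (s ! l))
        / to_fract (carlitz_gamma (s ! l)))"
      using assms by (intro prod.cong refl monic_power_sum_eq) simp
    also have "\<dots> = 1 / to_fract (Gamma_index s) *
      (\<Prod>l<length s. \<Sum>j\<in>{..degree (AT_H (s ! l - 1) :: 'a poly poly)}.
        to_fract theta ^ j * ?u l j ^ (CARD('a) ^ (is ! l)) / ?L (is ! l) ^ (s ! l))"
      by (simp add: prod_dividef Gamma_index_def)
    also have "(\<Prod>l<length s. \<Sum>j\<in>{..degree (AT_H (s ! l - 1) :: 'a poly poly)}.
        to_fract theta ^ j * ?u l j ^ (CARD('a) ^ (is ! l)) / ?L (is ! l) ^ (s ! l)) =
      (\<Sum>js\<in>J_index TYPE('a) s. \<Prod>l<length s.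
        to_fract theta ^ (js ! l) * ?u l (js ! l) ^ (CARD('a) ^ (is ! l)) / ?L (is ! l) ^ (s ! l))"
      unfolding J_index_eq by (rule prod_sum_lists) simp
    also have "\<dots> = (\<Sum>js\<in>J_index TYPE('a) s. to_fract (poly (a_poly js) theta)
      * (\<Prod>l<length s. (u_vec s js ! l) ^ (CARD('a) ^ (is ! l)) / ?L (is ! l) ^ (s ! l)))"
    proof (rule sum.cong)
      fix js assume "js \<in> J_index TYPE('a) s"
      then have len: "length js = length s" by (simp add: J_index_def)
      \<comment> \<open>The powers of theta from the separate factors combine to a_j(theta).\<close>
      have "to_fract (poly (a_poly js) theta) = (\<Prod>l<length s. to_fract theta ^ (js ! l) :: 'a poly fract)"
        by (simp add: a_poly_def poly_monom sum_list_sum_nth len atLeast0LessThan power_sum)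
      then show "(\<Prod>l<length s. to_fract theta ^ (js ! l) * ?u l (js ! l) ^ (CARD('a) ^ (is ! l))
          / ?L (is ! l) ^ (s ! l)) = to_fract (poly (a_poly js) theta)
        * (\<Prod>l<length s. (u_vec s js ! l) ^ (CARD('a) ^ (is ! l)) / ?L (is ! l) ^ (s ! l))"
        by (simp add: u_vec_def prod.distrib [symmetric] mult.assoc)
    qed simp
    finally show ?thesis .
  qed
  then have "(\<Sum>is\<in>Li_index s P. \<Prod>l<length s. monic_power_sum (is ! l) (s ! l)) =
    1 / to_fract (Gamma_index s) * (\<Sum>is\<in>Li_index s P. \<Sum>js\<in>J_index TYPE('a) s.
      to_fract (poly (a_poly js) theta)
      * (\<Prod>l<length s. (u_vec s js ! l) ^ (CARD('a) ^ (is ! l)) / ?L (is ! l) ^ (s ! l)))"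
    by (simp only: sum_distrib_left)
  also have "(\<Sum>is\<in>Li_index s P. \<Sum>js\<in>J_index TYPE('a) s. to_fract (poly (a_poly js) theta)
      * (\<Prod>l<length s. (u_vec s js ! l) ^ (CARD('a) ^ (is ! l)) / ?L (is ! l) ^ (s ! l))) =
    (\<Sum>js\<in>J_index TYPE('a) s. to_fract (poly (a_poly js) theta) * Li_sum s js P)"
    unfolding Li_sum_def sum_distrib_left by (rule sum.swap)
  finally show ?thesis unfolding zeta_sum_eq .
qed

section \<open>Reduction modulo $P$\<close>

text \<open>The constant term of \<open>prod_monics_eq\<close>, where E_d(0) = 0.\<close>

lemma prod_monics: "(\<Prod>a\<in>monics d. - a) = - (carlitz_D d :: 'a::{field,finite} poly)"
proof -
  have "to_fract (\<Prod>a\<in>monics d. - a) = poly (\<Prod>a\<in>monics d. [:- to_fract (a :: 'a poly), 1:]) 0"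
    by (simp add: poly_prod)
  also have "\<dots> = to_fract (- carlitz_D d)"
    unfolding prod_monics_eq
    by (simp add: carlitz_E_poly_def poly_sum poly_monom power_0_left)
  finally show ?thesis unfolding to_fract_eq_iff .
qed

lemma prime_elem_dvd_prodE:
  fixes f :: "'b \<Rightarrow> 'c::comm_semiring_1"
  assumes "prime_elem p" "p dvd prod f S"
  obtains x where "x \<in> S" "p dvd f x"
proof -
  have "\<exists>x\<in>S. p dvd f x"
    using assms(2)
  proof (induction S rule: infinite_finite_induct)
    case (insert x S)
    then show ?case using assms(1) by (auto simp: prime_elem_dvd_mult_iff)
  qed (use assms(1) in \<open>auto simp: prime_elem_def\<close>)
  with that show ?thesis by blast
qed

text \<open>By \<open>prod_monics\<close>, D_i is up to sign a product of monic polynomials of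
  degree i, too small to be divisible by P.\<close>

lemma not_dvd_carlitz_D:
  fixes P :: "'a::{field,finite} poly"
  assumes "irreducible P" "i < degree P"
  shows "\<not> P dvd carlitz_D i"
proof
  assume "P dvd carlitz_D i"
  then have "P dvd (\<Prod>a\<in>monics i. - a)" unfolding prod_monics by simp
  moreover have "prime_elem P" using assms(1) by (rule field_poly_irreducible_imp_prime)
  ultimately obtain a where a: "a \<in> monics i" "P dvd - a"
    by (metis prime_elem_dvd_prodE)
  then have "degree P \<le> i" using dvd_imp_degree_le[of P "- a"] by (cases "a = 0") (auto simp: monics_def)
  with assms(2) show False by simp
qed

text \<open>Each factor of $L_i$ divides, up to sign, some $D_j$, a product of polynomials of degree $j \le i$.\<close>

lemma not_dvd_carlitz_L:
  fixes P :: "'a::{field,finite} poly"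
  assumes "irreducible P" "i < degree P"
  shows "\<not> P dvd carlitz_L i"
proof
  assume dvd: "P dvd carlitz_L i"
  have "prime_elem P" using assms(1) by (rule field_poly_irreducible_imp_prime)
  with dvd obtain j where j: "j \<in> {1..i}" "P dvd theta - theta ^ (CARD('a) ^ j)"
    unfolding carlitz_L_def by (metis prime_elem_dvd_prodE)
  have "theta ^ (CARD('a) ^ j) - theta ^ (CARD('a) ^ 0) dvd (carlitz_D j :: 'a poly)"
    unfolding carlitz_D_def using j(1) by (intro dvd_prodI) auto
  moreover have "P dvd theta ^ (CARD('a) ^ j) - theta ^ (CARD('a) ^ 0)"
    using j(2) by (simp add: dvd_diff_commute)
  ultimately have "P dvd carlitz_D j" by (rule dvd_trans[rotated])
  with not_dvd_carlitz_D[of P j] assms j(1) show False by simp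
qed

text \<open>A relational form of \<open>residue\<close> in which c may be any representative of the
  class, so that sums and products need no reduction to small degree.\<close>

definition reduces_to :: "'a::{field,finite} poly \<Rightarrow> 'a poly fract \<Rightarrow> 'a poly \<Rightarrow> bool" where
  "reduces_to P x c \<longleftrightarrow> (\<exists>a b. x = Fract a b \<and> \<not> P dvd b \<and> P dvd b * c - a)"

context
  fixes P :: "'a::{field,finite} poly"
  assumes P: "irreducible P"
begin

lemma reduces_to_residue: "integral_at P x \<Longrightarrow> reduces_to P x (residue P x)"
  using residue_Fract[OF P] unfolding integral_at_def reduces_to_def by blast

lemma reduces_to_imp_integral_at: "reduces_to P x c \<Longrightarrow> integral_at P x"
  unfolding integral_at_def reduces_to_def by blast

lemma reduces_to_cong:
  assumes "reduces_to P x c"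
  shows "P dvd residue P x - c"
proof -
  from assms obtain a b where "x = Fract a b" "\<not> P dvd b" "P dvd b * c - a"
    unfolding reduces_to_def by blast
  then have "residue P x = c mod P" using residue_eqI[OF P] by simp
  then show ?thesis by (simp add: mod_eq_dvd_iff[symmetric])
qed

lemma prime_elem_P: "prime_elem P"
  using P by (rule field_poly_irreducible_imp_prime)

lemma reduces_to_add:
  assumes "reduces_to P x c" "reduces_to P y d"
  shows "reduces_to P (x + y) (c + d)"
proof -
  from assms obtain a b a' b' where
    x: "x = Fract a b" "\<not> P dvd b" "P dvd b * c - a" and
    y: "y = Fract a' b'" "\<not> P dvd b'" "P dvd b' * d - a'"
    unfolding reduces_to_def by blast
  then have nz: "b \<noteq> 0" "b' \<noteq> 0" by auto
  have "P dvd b' * (b * c - a) + b * (b' * d - a')" using x y by (intro dvd_add dvd_mult)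
  then have "P dvd b * b' * (c + d) - (a * b' + a' * b)" by (simp add: algebra_simps)
  moreover have "\<not> P dvd b * b'" using x y prime_elem_P by (simp add: prime_elem_dvd_mult_iff)
  ultimately show ?thesis using x y nz unfolding reduces_to_def by (metis add_fract)
qed

lemma reduces_to_mult:
  assumes "reduces_to P x c" "reduces_to P y d"
  shows "reduces_to P (x * y) (c * d)"
proof -
  from assms obtain a b a' b' where
    x: "x = Fract a b" "\<not> P dvd b" "P dvd b * c - a" and
    y: "y = Fract a' b'" "\<not> P dvd b'" "P dvd b' * d - a'"
    unfolding reduces_to_def by blast
  have "P dvd (b * c - a) * (b' * d) + a * (b' * d - a')" using x y by (intro dvd_add dvd_mult dvd_mult2)
  then have "P dvd b * b' * (c * d) - (a * a')" by (simp add: algebra_simps)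
  moreover have "\<not> P dvd b * b'" using x y prime_elem_P by (simp add: prime_elem_dvd_mult_iff)
  ultimately show ?thesis using x y unfolding reduces_to_def by (metis mult_fract)
qed

lemma reduces_to_to_fract: "reduces_to P (to_fract a) a"
proof -
  have "\<not> P dvd 1" using P by (simp add: irreducible_def)
  then show ?thesis unfolding reduces_to_def to_fract_def by (intro exI[of _ a] exI[of _ 1]) simp
qed

lemma reduces_to_sum:
  assumes "\<And>i. i \<in> S \<Longrightarrow> reduces_to P (f i) (g i)"
  shows "reduces_to P (\<Sum>i\<in>S. f i) (\<Sum>i\<in>S. g i)"
  using assms
proof (induction S rule: infinite_finite_induct)
  case (insert i S)
  then show ?case by (simp add: reduces_to_add)
qed (use reduces_to_to_fract[of 0] in simp_all)

lemma integral_at_to_fract: "integral_at P (to_fract a)"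
  using reduces_to_to_fract by (rule reduces_to_imp_integral_at)

lemma integral_at_mult: "integral_at P x \<Longrightarrow> integral_at P y \<Longrightarrow> integral_at P (x * y)"
  using reduces_to_residue reduces_to_mult reduces_to_imp_integral_at by blast

lemma integral_at_sum: "(\<And>i. i \<in> S \<Longrightarrow> integral_at P (f i)) \<Longrightarrow> integral_at P (\<Sum>i\<in>S. f i)"
  using reduces_to_residue reduces_to_sum[of S f "\<lambda>i. residue P (f i)"] reduces_to_imp_integral_at
  by blast

lemma integral_at_prod: "(\<And>i. i \<in> S \<Longrightarrow> integral_at P (f i)) \<Longrightarrow> integral_at P (\<Prod>i\<in>S. f i)"
proof (induction S rule: infinite_finite_induct)
  case (insert i S)
  then show ?case by (simp add: integral_at_mult)
qed (use integral_at_to_fract[of 1] in simp_all)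

lemma integral_at_divide:
  assumes "\<not> P dvd b"
  shows "integral_at P (to_fract a / to_fract b)"
  unfolding integral_at_def Fract_conv_to_fract using assms by blast

text \<open>The entries of \<open>u_vec\<close> lie in A, and the denominators are powers of L_i
  with i < deg P, hence prime to P.\<close>

lemma integral_at_Li_sum:
  "integral_at P (Li_sum s js P)"
  unfolding Li_sum_def
proof (intro integral_at_sum integral_at_prod)
  fix "is" l assume "is": "is \<in> Li_index s P" and l: "l \<in> {..<length s}"
  have "is ! l < degree P" using "is" l by (simp add: Li_index_def)
  then have "\<not> P dvd carlitz_L (is ! l) ^ (s ! l)"
    using not_dvd_carlitz_L[OF P] prime_elem_dvd_power[OF prime_elem_P] by blast
  then show "integral_at P ((u_vec s js ! l) ^ (CARD('a) ^ (is ! l)) / to_fract (carlitz_L (is ! l)) ^ (s ! l))"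
    unfolding to_fract_power[symmetric] using l
    by (simp add: u_vec_def integral_at_divide flip: to_fract_power)
qed

end

section \<open>The identity in the quotient ring\<close>

lemma sum_abs_Ak: "(\<Sum>i\<in>S. abs_Ak (f i)) = (abs_Ak (\<lambda>P. \<Sum>i\<in>S. f i P) :: 'a::{field,finite} Ak)"
  by (induction S rule: infinite_finite_induct) (simp_all add: zero_Ak_def plus_Ak.abs_eq)

theorem theorem3p3:
  fixes s :: "nat list"
  assumes "\<forall>n\<in>set s. 1 \<le> n"
  shows "(zeta_Ak s :: 'a::{field,finite} Ak) =
    (1 / to_fract (Gamma_index s)) *\<^sub>k
      (\<Sum>js\<in>J_index TYPE('a) s. to_fract (poly (a_poly js) theta) *\<^sub>k Li_Ak s (u_vec s js))"
proof -
  define a :: "nat list \<Rightarrow> 'a poly" where "a js = poly (a_poly js) theta" for js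
  \<comment> \<open>The representative of the right-hand side that results from unfolding
    \<open>scale_k\<close>.\<close>
  define rhs :: "'a poly \<Rightarrow> 'a poly" where
    "rhs = (\<lambda>P. residue P (1 / to_fract (Gamma_index s)) *
      (\<Sum>js\<in>J_index TYPE('a) s. residue P (to_fract (a js)) * residue P (Li_sum s js P)))"
  have nz: "Gamma_index s \<noteq> (0 :: 'a poly)"
    by (simp add: Gamma_index_def carlitz_gamma_nonzero)
  have "Ak_rel (zeta_Ak_at s) rhs"
  \<comment> \<open>The exceptional P are the divisors of Gamma_s, where the residue of 1 / Gamma_s
    is the default 0. At all other P every term is integral, so reduction commutes with the sums and
    products.\<close>
  proof (rule Ak_relI[OF finite_divisors_poly[OF nz]])
    fix P :: "'a poly" assume "monic_irreducible P" "P \<notin> {P. P dvd Gamma_index s}"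
    then have P: "irreducible P" and G: "\<not> P dvd Gamma_index s" by (auto simp: monic_irreducible_def)
    have "integral_at P (1 / to_fract (Gamma_index s))"
      using integral_at_divide[OF P G, of 1] by simp
    then have "reduces_to P (1 / to_fract (Gamma_index s) *
        (\<Sum>js\<in>J_index TYPE('a) s. to_fract (a js) * Li_sum s js P)) (rhs P)"
      unfolding rhs_def using integral_at_Li_sum[OF P] integral_at_to_fract[OF P]
      by (intro reduces_to_mult[OF P] reduces_to_sum[OF P] reduces_to_residue[OF P])
    then show "P dvd zeta_Ak_at s P - rhs P"
      unfolding zeta_Ak_at_def zeta_sum_eq_Li_sum[OF assms] a_def by (rule reduces_to_cong[OF P])
  qed
  then have "zeta_Ak s = abs_Ak rhs"
    by (simp add: zeta_Ak_def Ak.abs_eq_iff)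
  also have "\<dots> = (1 / to_fract (Gamma_index s)) *\<^sub>k
      (\<Sum>js\<in>J_index TYPE('a) s. to_fract (a js) *\<^sub>k abs_Ak (\<lambda>P. residue P (Li_sum s js P)))"
    by (simp add: scale_k.abs_eq sum_abs_Ak rhs_def)
  also have "(\<lambda>js. abs_Ak (\<lambda>P. residue P (Li_sum s js P))) = (\<lambda>js. Li_Ak s (u_vec s js :: 'a poly fract list))"
    by (simp add: Li_Ak.abs_eq Li_Ak_at_def [abs_def] Li_sum_def)
  finally show ?thesis unfolding a_def .
qed

end
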